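(* Let $G$ be a nonsingular even integral symmetric $n\times n$ matrix ($n\ge1$), $D=\det(G)$ (possibly negative), $N$ its level. Let $c$ be a positive integer with $\gcd(N,c)=1$ (equivalently $\gcd(D,c)=1$), $a$ a nonzero integer with $\gcd(a,c)=1$, and $\mathbf{w},\mathbf{x}\in\mathbb{Q}^n$ with $G\mathbf{w}\in\mathbb{Z}^n$, $a\mathbf{x}\in\mathbb{Z}^n$. Then $$\sum_{\mathbf{v}\in\{0,\dots,c-1\}^n}e\!\left(\frac{a}{c}\Big(\tfrac12(\mathbf{v}+\mathbf{w})^{T}G(\mathbf{v}+\mathbf{w})+(\mathbf{v}+\mathbf{w})^{T}\mathbf{x}\Big)\right)$$ $$=c^{n/2}\left(\frac{|a|}{c}\right)_K^n\left(\frac{D}{c}\right)_K e\!\left(\frac{n\,\mathrm{sgn}(a)(1-c_0)}{8}\right)e\!\left(-\frac{a}{2c}\mathbf{x}^{T}G^{-1}\mathbf{x}+\frac{ac'}{2}(\mathbf{w}+G^{-1}\mathbf{x})^{T}G(\mathbf{w}+G^{-1}\mathbf{x})\right),$$ where $c_0$ is the odd part of $c$ and $c'$ is any integer with $cc'\equiv1\pmod{aN}$.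
   Context: $e(z)=\exp(2\pi i z)$. Even integral: integer entries with even diagonal. The level of $G$ is the least positive integer $N$ with $NG^{-1}$ even integral. $(\frac{\cdot}{\cdot})_K$ is the Kronecker–Jacobi symbol; $c=2^ec_0$ with $c_0$ odd; $c^{n/2}>0$. *)

theory Defs
  imports
    Complex_Main
    "HOL-Number_Theory.Number_Theory"
    "Jordan_Normal_Form.Matrix"
    "Jordan_Normal_Form.Determinant"
    "Jordan_Normal_Form.Gauss_Jordan_Elimination"
begin

definition e_fun :: "complex \<Rightarrow> complex" where
  "e_fun z = exp (2 * of_real pi * \<i> * z)"

text \<open>The Kronecker-Jacobi symbol \<open>(m/k)\<close>, extended multiplicatively from primes to nonzero \<open>k\<close>. Over \<open>int\<close>,
  \<^const>\<open>prime_factorization\<close> ignores the sign of \<open>k\<close> and yields positive primes.\<close>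

definition kronecker_prime :: "int \<Rightarrow> int \<Rightarrow> int" where
  "kronecker_prime m p =
     (if p = 2 then (if even m then 0 else if m mod 8 = 1 \<or> m mod 8 = 7 then 1 else - 1)
      else Legendre m p)"

definition kronecker :: "int \<Rightarrow> int \<Rightarrow> int" where
  "kronecker m k =
     (if k = 0 then (if \<bar>m\<bar> = 1 then 1 else 0)
      else (if k < 0 \<and> m < 0 then - 1 else 1)
           * prod_mset (image_mset (kronecker_prime m) (prime_factorization k)))"

abbreviation rat_mat :: "int mat \<Rightarrow> rat mat" where
  "rat_mat \<equiv> map_mat rat_of_int"

abbreviation rat_vec :: "int vec \<Rightarrow> rat vec" where
  "rat_vec \<equiv> map_vec rat_of_int"

definition integral_vec :: "rat vec \<Rightarrow> bool" where
  "integral_vec v \<longleftrightarrow> (\<forall>i < dim_vec v. v $ i \<in> \<int>)"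

text \<open>Stated for rational matrices, because it is also applied to multiples of \<open>G\<^sup>-\<^sup>1\<close>.\<close>

definition even_integral :: "rat mat \<Rightarrow> bool" where
  "even_integral A \<longleftrightarrow>
     (\<forall>i < dim_row A. \<forall>j < dim_col A. A $$ (i, j) \<in> \<int>) \<and>
     (\<forall>i < dim_row A. \<exists>m :: int. A $$ (i, i) = of_int (2 * m))"

text \<open>The inverse of a nonsingular matrix; unspecified for singular ones.\<close>

definition inv_mat :: "rat mat \<Rightarrow> rat mat" where
  "inv_mat A = the (mat_inverse A)"

lemma inv_mat:
  assumes A: "A \<in> carrier_mat n n" and d: "det A \<noteq> 0"
  shows "inv_mat A \<in> carrier_mat n n" "A * inv_mat A = 1\<^sub>m n" "inv_mat A * A = 1\<^sub>m n"
proof -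
  have "A \<in> Units (ring_mat TYPE(rat) n undefined)"
    using det_non_zero_imp_unit[OF A d] .
  then obtain B where "mat_inverse A = Some B"
    using mat_inverse(1)[OF A, of undefined] by (cases "mat_inverse A") auto
  then show "inv_mat A \<in> carrier_mat n n" "A * inv_mat A = 1\<^sub>m n" "inv_mat A * A = 1\<^sub>m n"
    using mat_inverse(2)[OF A] by (auto simp: inv_mat_def)
qed

definition level :: "int mat \<Rightarrow> nat" where
  "level G = (LEAST N. N > 0 \<and> even_integral (rat_of_nat N \<cdot>\<^sub>m inv_mat (rat_mat G)))"

text \<open>The minimum is attained, since \<open>2 \<bar>det G\<bar> G\<^sup>-\<^sup>1\<close> is even integral.\<close>

lemma level:
  assumes G: "G \<in> carrier_mat n n" and d: "det G \<noteq> 0"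
  shows "level G > 0" "even_integral (rat_of_nat (level G) \<cdot>\<^sub>m inv_mat (rat_mat G))"
proof -
  let ?A = "rat_mat G" and ?N = "nat (2 * \<bar>det G\<bar>)"
  have A: "?A \<in> carrier_mat n n" using G by simp
  have dA: "det ?A = of_int (det G)" by simp
  then have dA0: "det ?A \<noteq> 0" using d by simp
  note I = inv_mat[OF A dA0]
  have "rat_mat (adj_mat G) = inv_mat ?A * (?A * rat_mat (adj_mat G))"
    using I A adj_mat(1)[OF G]
    by (subst assoc_mult_mat[symmetric, of _ n n _ n _ n]) auto
  also have "?A * rat_mat (adj_mat G) = rat_mat (G * adj_mat G)"
    by (rule of_int_hom.mat_hom_mult[OF G adj_mat(1)[OF G], symmetric])
  also have "\<dots> = of_int (det G) \<cdot>\<^sub>m 1\<^sub>m n"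
    by (subst adj_mat(2)[OF G]) (auto intro!: eq_matI)
  finally have adj: "rat_mat (adj_mat G) = of_int (det G) \<cdot>\<^sub>m inv_mat ?A"
    using I(1) mult_smult_distrib[OF I(1) one_carrier_mat[of n]] by (simp add: right_mult_one_mat)
  have ent: "of_int (det G) * inv_mat ?A $$ (i, j) = rat_of_int (adj_mat G $$ (i, j))"
    if "i < n" "j < n" for i j
    using arg_cong[OF adj, of "\<lambda>M. M $$ (i, j)"] that I(1) adj_mat(1)[OF G] by simp
  have ent2: "(rat_of_nat ?N \<cdot>\<^sub>m inv_mat ?A) $$ (i, j)
      = of_int (2 * (sgn (det G) * adj_mat G $$ (i, j)))" if "i < n" "j < n" for i j
  proof -
    have "rat_of_nat ?N = 2 * of_int (sgn (det G) * det G)"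
      by (cases "det G \<ge> 0") (auto simp: sgn_if)
    then show ?thesis
      using that I(1) ent[OF that, symmetric] by simp
  qed
  have "?N > 0 \<and> even_integral (rat_of_nat ?N \<cdot>\<^sub>m inv_mat ?A)"
    unfolding even_integral_def
  proof (intro conjI allI impI)
    show "?N > 0" using d by simp
  next
    fix i j assume "i < dim_row (rat_of_nat ?N \<cdot>\<^sub>m inv_mat ?A)"
      "j < dim_col (rat_of_nat ?N \<cdot>\<^sub>m inv_mat ?A)"
    then have "i < n" "j < n" using I(1) by auto
    from ent2[OF this] show "(rat_of_nat ?N \<cdot>\<^sub>m inv_mat ?A) $$ (i, j) \<in> \<int>"
      by (metis Ints_of_int)
  next
    fix i assume "i < dim_row (rat_of_nat ?N \<cdot>\<^sub>m inv_mat ?A)"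
    then have "i < n" using I(1) by auto
    from ent2[OF this this]
    show "\<exists>m. (rat_of_nat ?N \<cdot>\<^sub>m inv_mat ?A) $$ (i, i) = of_int (2 * m)" by blast
  qed
  from LeastI[of "\<lambda>N. N > 0 \<and> even_integral (rat_of_nat N \<cdot>\<^sub>m inv_mat ?A)", OF this]
  show "level G > 0" "even_integral (rat_of_nat (level G) \<cdot>\<^sub>m inv_mat (rat_mat G))"
    unfolding level_def by auto
qed

text \<open>The value \<open>v\<^sup>T A v\<close>.\<close>

definition qform :: "rat mat \<Rightarrow> rat vec \<Rightarrow> rat" where
  "qform A v = v \<bullet> (A *\<^sub>v v)"

definition box_vecs :: "nat \<Rightarrow> int \<Rightarrow> int vec set" where
  "box_vecs n c = {v \<in> carrier_vec n. \<forall>i < n. v $ i \<in> {0..c - 1}}"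

lemma finite_box_vecs: "finite (box_vecs n c)"
proof -
  have "box_vecs n c \<subseteq> vec_of_list ` {xs. set xs \<subseteq> {0..c - 1} \<and> length xs = n}"
  proof
    fix v assume v: "v \<in> box_vecs n c"
    then have "set (list_of_vec v) \<subseteq> {0..c - 1}" "length (list_of_vec v) = n"
      by (auto simp: box_vecs_def in_set_conv_nth list_of_vec_index)
    then show "v \<in> vec_of_list ` {xs. set xs \<subseteq> {0..c - 1} \<and> length xs = n}"
      by (metis (mono_tags, lifting) imageI mem_Collect_eq vec_list)
  qed
  then show ?thesis
    by (rule finite_subset) (intro finite_imageI finite_lists_length_eq, simp)
qed

end

theory Submission
  imports Defs
begin

text \<open>
  Completing the square and using \<open>c c' \<equiv> 1 (mod a N)\<close> to split the denominator \<open>a N c\<close> reduces the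
  sum, up to explicit phases, to \<open>S(G, a, c)\<close>, the sum of \<open>e(a v\<^sup>T G v / (2 c))\<close> over \<open>v\<close> modulo \<open>c\<close>.
  This sum is twisted multiplicative in \<open>c\<close>, changes by the factor \<open>p\<^sup>n\<close> when \<open>c\<close> is divided by
  \<open>p\<^sup>2\<close>, and is invariant under \<open>G \<mapsto> U\<^sup>T G U\<close> with \<open>det U\<close> prime to \<open>c\<close>. Hence only prime moduli
  remain, where \<open>G\<close> decomposes into blocks of size 1 (\<open>p\<close> odd) or 2 (\<open>p = 2\<close>). For odd \<open>c\<close> this
  gives \<open>S(G, a, c) = (D/c) g(2a, c)\<^sup>n\<close> with the one-dimensional Gauss sum \<open>g(b, c)\<close>, and
  \<open>g(2, c) = \<surd>c e((1 - c)/8)\<close> comes from Gauss's product formula for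
  \<open>\<Sum>\<^sub>j e(j (j + 1) / (2 c))\<close>: the phases of its factors add up exactly, all sines in it being
  positive.
\<close>

section \<open>One-dimensional Gauss sums\<close>

text \<open>The prime 2 shapes the development. Over an odd prime a form can be diagonalised, but an
  even form is alternating modulo 2, so only blocks of size 2 can be split off there, and an odd
  determinant forces \<open>n\<close> to be even. For even \<open>c\<close> this parity makes the
  symbols of \<open>|a|\<close> and of the twist by \<open>2 ^ k\<close> disappear, and the power of
  2 in \<open>c\<close> contributes only a real factor; hence only \<open>c0\<close> enters the
  eighth root of unity. The sum \<open>g(2, c)\<close> is taken as the basic one because
  \<open>2 x^2\<close> with \<open>x = (2 j + 1) / 4\<close> modulo \<open>c\<close> is the
  triangular number \<open>j (j + 1) / 2\<close> plus \<open>1/8\<close>, and at a root of unity the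
  Gaussian binomials are signed powers with triangular exponents. No distinction of \<open>c\<close>
  modulo 4 arises, and negative \<open>a\<close> is handled by complex conjugation. The level enters
  through \<open>H = N G^{-1}\<close>, which is again an even form: for the integer vector
  \<open>z\<close> that carries the linear term, \<open>z^T H z / 2\<close> is an integer, and the
  phases produced by completing the square are compared as rational multiples of it.\<close>

definition ec :: "int \<Rightarrow> int \<Rightarrow> complex" where
  "ec c m = e_fun (of_int m / of_int c)"

lemma e_fun_add: "e_fun (x + y) = e_fun x * e_fun y"
  by (simp add: e_fun_def distrib_left exp_add)

lemma e_fun_0 [simp]: "e_fun 0 = 1"
  by (simp add: e_fun_def)

lemma e_fun_of_real: "e_fun (of_real t) = cis (2 * pi * t)"
  by (simp add: e_fun_def cis_conv_exp mult_ac)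

lemma e_fun_of_int [simp]: "e_fun (of_int m) = 1"
  using e_fun_of_real[of "of_int m"] by (simp add: cis_multiple_2pi)

lemma norm_e_fun_of_real [simp]: "norm (e_fun (of_real t)) = 1"
  by (simp add: e_fun_of_real)

lemma cnj_e_fun_of_real: "cnj (e_fun (of_real t)) = e_fun (- of_real t)"
  using e_fun_of_real[of "- t"] by (simp add: e_fun_of_real cis_cnj)

lemma e_fun_power: "e_fun z ^ n = e_fun (of_nat n * z)"
  by (induction n) (simp_all add: e_fun_add algebra_simps)

lemma ec_add: "ec c (x + y) = ec c x * ec c y"
  by (simp add: ec_def add_divide_distrib e_fun_add)

lemma ec_0 [simp]: "ec c 0 = 1"
  by (simp add: ec_def)

lemma ec_dvd: "c dvd m \<Longrightarrow> ec c m = 1"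
  by (cases "c = 0") (auto simp: ec_def elim!: dvdE)

lemma ec_cong: "[x = y] (mod c) \<Longrightarrow> ec c x = ec c y"
  using ec_add[of c y "x - y"] ec_dvd[of c "x - y"]
  by (simp add: cong_iff_dvd_diff)

lemma ec_mod: "ec c (m mod c) = ec c m"
  by (rule ec_cong) (simp add: cong_def)

lemma ec_eq_1_iff:
  assumes "c \<noteq> 0"
  shows "ec c m = 1 \<longleftrightarrow> c dvd m"
proof
  assume "ec c m = 1"
  then have "cis (2 * pi * (of_int m / of_int c)) = 1"
    using e_fun_of_real[of "of_int m / of_int c"] by (simp add: ec_def)
  then have "cos (2 * pi * (of_int m / of_int c)) = 1"
    by (simp add: complex_eq_iff)
  then obtain k :: int where "2 * pi * (of_int m / of_int c) = of_int k * 2 * pi"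
    by (auto simp: cos_one_2pi_int)
  then have "real_of_int m = of_int (k * c)"
    using assms by (simp add: field_simps)
  then show "c dvd m"
    by (simp only: of_int_eq_iff) simp
qed (rule ec_dvd)

lemma ec_scale: "k \<noteq> 0 \<Longrightarrow> ec (k * c) (k * m) = ec c m"
  by (simp add: ec_def)

lemma ec_uminus: "ec c (- m) = cnj (ec c m)"
  using cnj_e_fun_of_real[of "of_int m / of_int c"] by (simp add: ec_def)

lemma ec_power: "ec c m ^ k = ec c (int k * m)"
  by (simp add: ec_def e_fun_power)

lemma ec_mult_cnj: "ec c x * cnj (ec c y) = ec c (x - y)"
  using ec_add[of c x "- y"] by (simp add: ec_uminus)

lemma ec_two: "ec 2 m = (if even m then 1 else - 1)"
proof -
  have "ec 2 1 = - 1"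
    using exp_pi_i by (simp add: ec_def e_fun_def mult_ac)
  then show ?thesis
    using ec_mod[of 2 m] by (auto simp: ec_dvd odd_iff_mod_2_eq_one)
qed

definition gauss_sum :: "int \<Rightarrow> int \<Rightarrow> complex" where
  "gauss_sum b c = (\<Sum>x\<in>{0..<c}. ec c (b * x\<^sup>2))"

text \<open>The map \<open>u * x + s\<close> permutes the residues modulo \<open>c\<close>, and
  \<open>f\<close> sees only residues.\<close>

lemma sum_affine_mod:
  fixes f :: "int \<Rightarrow> 'a :: comm_monoid_add"
  assumes c: "c > 0" and u: "coprime u c"
    and f: "\<And>x y. [x = y] (mod c) \<Longrightarrow> f x = f y"
  shows "(\<Sum>x\<in>{0..<c}. f (u * x + s)) = (\<Sum>x\<in>{0..<c}. f x)"
proof -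
  let ?h = "\<lambda>x. (u * x + s) mod c"
  have inj: "inj_on ?h {0..<c}"
  proof (rule inj_onI)
    fix x y assume xy: "x \<in> {0..<c}" "y \<in> {0..<c}" "?h x = ?h y"
    then have "[u * x = u * y] (mod c)"
      by (simp add: cong_def mod_eq_dvd_iff)
    then have "[x = y] (mod c)"
      using u by (simp add: cong_mult_lcancel)
    then show "x = y" using xy by (simp add: cong_def)
  qed
  have "?h ` {0..<c} = {0..<c}"
    by (rule endo_inj_surj) (use inj c in auto)
  then have "(\<Sum>x\<in>{0..<c}. f x) = (\<Sum>x\<in>{0..<c}. f (?h x))"
    using sum.reindex[OF inj, of f] by simp
  also have "\<dots> = (\<Sum>x\<in>{0..<c}. f (u * x + s))"
    by (intro sum.cong refl f) (simp add: cong_def)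
  finally show ?thesis by simp
qed

text \<open>Shifting \<open>x\<close> by 1 multiplies the sum by \<open>ec c m\<close>, which
  differs from 1 unless \<open>c\<close> divides \<open>m\<close>.\<close>

lemma sum_ec:
  assumes c: "c > 0"
  shows "(\<Sum>x\<in>{0..<c}. ec c (m * x)) = (if c dvd m then of_int c else 0)"
proof (cases "c dvd m")
  case True
  then show ?thesis using c by (simp add: ec_dvd)
next
  case False
  let ?S = "\<Sum>x\<in>{0..<c}. ec c (m * x)"
  have "?S = (\<Sum>x\<in>{0..<c}. ec c (m * (1 * x + 1)))"
    using c by (intro sum_affine_mod[symmetric] ec_cong cong_mult) auto
  also have "\<dots> = ec c m * ?S"
    by (simp add: sum_distrib_left algebra_simps ec_add)
  finally have "(1 - ec c m) * ?S = 0"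
    by (simp add: algebra_simps)
  then show ?thesis
    using False c ec_eq_1_iff[of c m] by simp
qed

section \<open>Gaussian binomials and Gauss's product formula\<close>

fun qbinomial :: "'a :: comm_ring_1 \<Rightarrow> nat \<Rightarrow> nat \<Rightarrow> 'a" where
  "qbinomial q n 0 = 1"
| "qbinomial q 0 (Suc k) = 0"
| "qbinomial q (Suc n) (Suc k) = qbinomial q n k + q ^ Suc k * qbinomial q n (Suc k)"

lemma qbinomial_eq_0: "n < k \<Longrightarrow> qbinomial q n k = 0"
  by (induction q n k rule: qbinomial.induct) auto

text \<open>Pascal's rule turns the ratio of neighbouring entries of row \<open>n\<close> into an
  absorption identity for row \<open>n + 1\<close>. The ratio is a hypothesis so that the induction
  which establishes it can apply this step to its own induction hypothesis.\<close>

lemma qbinomial_absorb_step: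
  fixes q :: "'a :: comm_ring_1"
  assumes k: "k \<le> n"
    and step: "(1 - q ^ Suc k) * qbinomial q n (Suc k) = (1 - q ^ (n - k)) * qbinomial q n k"
  shows "(1 - q ^ Suc k) * qbinomial q (Suc n) (Suc k) = (1 - q ^ Suc n) * qbinomial q n k"
proof -
  have "(1 - q ^ Suc k) * qbinomial q (Suc n) (Suc k) =
    (1 - q ^ Suc k) * qbinomial q n k + q ^ Suc k * ((1 - q ^ Suc k) * qbinomial q n (Suc k))"
    by (simp add: algebra_simps)
  also have "\<dots> = (1 - q ^ Suc k * q ^ (n - k)) * qbinomial q n k"
    by (simp only: step) (simp add: algebra_simps)
  also have "q ^ Suc k * q ^ (n - k) = q ^ Suc n"
    using k by (subst power_add[symmetric]) simp
  finally show ?thesis .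
qed

text \<open>Both sides of the inductive step equal \<open>(1 - q ^ Suc n) * qbinomial q n k\<close>,
  the left one by absorption and the right one by Pascal's rule. Nothing is divided, because factors
  \<open>1 - q ^ i\<close> vanish at the root of unity used later.\<close>

lemma qbinomial_Suc_right:
  "k \<le> n \<Longrightarrow> (1 - q ^ Suc k) * qbinomial q n (Suc k) = (1 - q ^ (n - k)) * qbinomial q n k"
proof (induction n arbitrary: k)
  case 0
  then show ?case by simp
next
  case (Suc n)
  note absorb = qbinomial_absorb_step[OF _ Suc.IH]
  show ?case
  proof (cases "k = Suc n")
    case True
    then show ?thesis by (simp add: qbinomial_eq_0)
  next
    case False
    then have k: "k \<le> n" using Suc.prems by simp
    show ?thesis
    proof (cases k)
      case 0
      then show ?thesis using absorb[OF le0 le0] by simp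
    next
      case (Suc j)
      then have j: "j \<le> n" "Suc n - k = n - j" using k by auto
      have "(1 - q ^ (n - j)) * qbinomial q (Suc n) k =
          (1 - q ^ (n - j)) * qbinomial q n j + q ^ k * (1 - q ^ (n - j)) * qbinomial q n k"
        by (simp add: Suc algebra_simps)
      also have "\<dots> = (1 - q ^ k * q ^ (n - j)) * qbinomial q n k"
        using Suc.IH[OF j(1)] by (simp add: Suc algebra_simps)
      also have "q ^ k * q ^ (n - j) = q ^ Suc n"
        using Suc k by (subst power_add[symmetric]) simp
      finally show ?thesis
        using absorb[OF k k] j(2) by simp
    qed
  qed
qed

lemma qbinomial_absorb:
  "k \<le> n \<Longrightarrow> (1 - q ^ Suc k) * qbinomial q (Suc n) (Suc k) = (1 - q ^ Suc n) * qbinomial q n k"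
  by (intro qbinomial_absorb_step qbinomial_Suc_right)

text \<open>Pascal's rule cancels most of the alternating sum and leaves the terms
  \<open>(1 - q ^ Suc j) * qbinomial q (Suc n) (Suc j)\<close>, to which absorption applies.\<close>

lemma alternating_sum_qbinomial_step:
  fixes q :: "'a :: comm_ring_1"
  shows
  "(\<Sum>j\<le>Suc (Suc n). (- 1) ^ j * qbinomial q (Suc (Suc n)) j) =
   (1 - q ^ Suc n) * (\<Sum>j\<le>n. (- 1) ^ j * qbinomial q n j)"
proof -
  let ?b = "qbinomial q (Suc n)"
  have "(\<Sum>j\<le>Suc (Suc n). (- 1) ^ j * qbinomial q (Suc (Suc n)) j) =
      1 - (\<Sum>j\<le>Suc n. (- 1) ^ j * ?b j) - (\<Sum>j\<le>Suc n. (- 1) ^ j * (q ^ Suc j * ?b (Suc j)))"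
    unfolding sum.atMost_Suc_shift[of _ "Suc n"] qbinomial.simps(3)[of q "Suc n"]
    by (simp add: sum_subtractf sum_negf distrib_left del: sum.atMost_Suc qbinomial.simps(3))
  also have "(\<Sum>j\<le>Suc n. (- 1) ^ j * (q ^ Suc j * ?b (Suc j))) =
      (\<Sum>j\<le>n. (- 1) ^ j * (q ^ Suc j * ?b (Suc j)))"
    by (simp add: qbinomial_eq_0 del: qbinomial.simps(3))
  also have "(\<Sum>j\<le>Suc n. (- 1) ^ j * ?b j) = 1 - (\<Sum>j\<le>n. (- 1) ^ j * ?b (Suc j))"
    by (subst sum.atMost_Suc_shift) (simp add: sum_negf del: qbinomial.simps(3))
  also have "1 - (1 - (\<Sum>j\<le>n. (- 1) ^ j * ?b (Suc j))) -
      (\<Sum>j\<le>n. (- 1) ^ j * (q ^ Suc j * ?b (Suc j))) =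
      (\<Sum>j\<le>n. (- 1) ^ j * ((1 - q ^ Suc j) * ?b (Suc j)))"
    by (simp add: sum_subtractf algebra_simps del: qbinomial.simps(3))
  also have "\<dots> = (\<Sum>j\<le>n. (1 - q ^ Suc n) * ((- 1) ^ j * qbinomial q n j))"
  proof (rule sum.cong[OF refl])
    fix j assume "j \<in> {..n}"
    then show "(- 1) ^ j * ((1 - q ^ Suc j) * ?b (Suc j)) =
        (1 - q ^ Suc n) * ((- 1) ^ j * qbinomial q n j)"
      by (simp only: qbinomial_absorb atMost_iff) (simp add: algebra_simps)
  qed
  finally show ?thesis by (simp add: sum_distrib_left)
qed

lemma alternating_sum_qbinomial:
  fixes q :: "'a :: comm_ring_1"
  shows
  "(\<Sum>j\<le>2 * m. (- 1) ^ j * qbinomial q (2 * m) j) = (\<Prod>i<m. 1 - q ^ (2 * i + 1))"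
proof (induction m)
  case (Suc m)
  then show ?case
    using alternating_sum_qbinomial_step[of q "2 * m"] by (simp add: mult.commute)
qed simp

text \<open>As \<open>1 - q ^ Suc n\<close> vanishes and \<open>1 - q ^ Suc j\<close> does not,
  absorption kills entry \<open>Suc j\<close> of row \<open>n + 1\<close>. Pascal's rule then
  relates neighbours in row \<open>n\<close> by the factor \<open>- q ^ Suc j\<close>, and these
  exponents add up to triangular numbers.\<close>

lemma qbinomial_root_of_unity:
  fixes q :: "'a :: field"
  assumes "q ^ Suc n = 1" and "\<And>j. 0 < j \<Longrightarrow> j \<le> n \<Longrightarrow> q ^ j \<noteq> 1"
  shows "j \<le> n \<Longrightarrow> (- 1) ^ j * qbinomial q n j * q ^ (j * (j + 1) div 2) = 1"
proof (induction j)
  case (Suc j)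
  have "qbinomial q (Suc n) (Suc j) = 0"
    using qbinomial_absorb[of j n q] Suc.prems assms(1) assms(2)[of "Suc j"] by auto
  then have *: "qbinomial q n j = - (q ^ Suc j * qbinomial q n (Suc j))"
    by (simp add: eq_neg_iff_add_eq_0)
  have "Suc j * (Suc j + 1) div 2 = j * (j + 1) div 2 + Suc j"
    by (simp add: algebra_simps div_eq_dividend_iff)
  then show ?case
    using Suc by (simp add: * power_add mult_ac)
qed simp

text \<open>Row \<open>2 * m\<close> is taken at a primitive \<open>c\<close>-th root of unity,
  where its alternating sum becomes the theta sum. The root is \<open>ec c (- 1)\<close> rather than
  \<open>ec c 1\<close> because the entries are inverse powers of it.\<close>

lemma theta_sum_eq_prod:
  fixes m :: nat
  defines "c \<equiv> 2 * int m + 1"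
  shows "(\<Sum>j\<in>{0..<c}. ec c (j * (j + 1) div 2)) = (\<Prod>i<m. 1 - ec c (- (2 * int i + 1)))"
proof -
  let ?q = "ec c (- 1)"
  have pow: "?q ^ k = ec c (- int k)" for k
    by (simp add: ec_power)
  have c: "c \<noteq> 0" by (simp add: c_def)
  have root: "?q ^ Suc (2 * m) = 1"
    unfolding pow by (rule ec_dvd, subst dvd_minus_iff) (simp add: c_def add.commute)
  have prim: "?q ^ j \<noteq> 1" if "0 < j" "j \<le> 2 * m" for j
    unfolding pow ec_eq_1_iff[OF c] using that zdvd_imp_le[of c "int j"] by (auto simp: c_def)
  have coef: "(- 1) ^ j * qbinomial ?q (2 * m) j = ec c (int j * (int j + 1) div 2)"
    if "j \<le> 2 * m" for j
  proof -
    have "(- 1) ^ j * qbinomial ?q (2 * m) j * ec c (- (int j * (int j + 1) div 2)) = 1"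
      using qbinomial_root_of_unity[OF root prim that]
      by (simp add: pow zdiv_int algebra_simps)
    moreover have "ec c (- (int j * (int j + 1) div 2)) * ec c (int j * (int j + 1) div 2) = 1"
      by (simp flip: ec_add)
    ultimately show ?thesis
      by (metis mult.assoc mult.right_neutral mult_1)
  qed
  have img: "{0..<c} = int ` {..2 * m}"
    using image_int_atLeastAtMost[of 0 "2 * m"] by (auto simp: c_def atMost_atLeast0)
  have "(\<Sum>j\<in>{0..<c}. ec c (j * (j + 1) div 2)) =
      (\<Sum>j\<le>2 * m. (- 1) ^ j * qbinomial ?q (2 * m) j)"
    unfolding img by (subst sum.reindex) (auto simp: coef)
  also have "\<dots> = (\<Prod>i<m. 1 - ec c (- (2 * int i + 1)))"
    unfolding alternating_sum_qbinomial pow by (simp add: add_ac)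
  finally show ?thesis .
qed

text \<open>Half the angle is factored out: \<open>e(t/2) - e(-t/2)\<close> is
  \<open>2 i sin (pi t)\<close>, and \<open>i\<close> contributes the phase 1/4.\<close>

lemma one_minus_e_fun:
  "1 - e_fun (- of_real t) = e_fun (1 / 4 - of_real t / 2) * of_real (2 * sin (pi * t))"
proof -
  have i: "e_fun (1 / 4) = \<i>"
    using cis_conv_exp[of "pi / 2"] by (simp add: e_fun_def mult_ac)
  from e_fun_of_real[of "t / 2"] e_fun_of_real[of "- (t / 2)"]
  have s: "e_fun (of_real t / 2) - e_fun (- (of_real t / 2)) = 2 * \<i> * of_real (sin (pi * t))"
    by (simp add: complex_eq_iff)
  have "1 - e_fun (- of_real t) =
      e_fun (- (of_real t / 2)) * (e_fun (of_real t / 2) - e_fun (- (of_real t / 2)))"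
    by (simp add: right_diff_distrib flip: e_fun_add)
  also have "\<dots> = e_fun (1 / 4 + - (of_real t / 2)) * of_real (2 * sin (pi * t))"
    unfolding s e_fun_add i by simp
  finally show ?thesis by simp
qed

lemma e_fun_sum: "finite A \<Longrightarrow> e_fun (\<Sum>i\<in>A. f i) = (\<Prod>i\<in>A. e_fun (f i))"
  by (induction A rule: finite_induct) (simp_all add: e_fun_add)

text \<open>The angles \<open>(2 i + 1) / c\<close> with \<open>i < m\<close> lie strictly between 0
  and 1, so every sine is positive and goes into \<open>P\<close>. The phase involves the sum of the
  first \<open>m\<close> odd numbers, which is \<open>m^2\<close>.\<close>

lemma theta_prod_polar:
  fixes m :: nat
  defines "c \<equiv> 2 * int m + 1"
  shows "\<exists>P>0. (\<Prod>i<m. 1 - ec c (- (2 * int i + 1))) =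
    e_fun (of_nat m / 4 - of_nat (m\<^sup>2) / (2 * of_int c)) * of_real P"
proof (intro exI conjI)
  define t where "t i = (2 * real i + 1) / of_int c" for i
  let ?P = "\<Prod>i<m. 2 * sin (pi * t i)"
  have c: "c > 0" by (simp add: c_def)
  have "sin (pi * t i) > 0" if "i < m" for i
  proof (rule sin_gt_zero)
    have "0 < t i" "t i < 1"
      using that c by (auto simp: t_def c_def)
    then show "0 < pi * t i" "pi * t i < pi" by auto
  qed
  then show "?P > 0" by (intro prod_pos) auto
  have sum_odd: "(\<Sum>i<m. 2 * complex_of_nat i + 1) = of_nat (m\<^sup>2)"
    by (induction m) (auto simp: power2_eq_square algebra_simps)
  have "(\<Prod>i<m. 1 - ec c (- (2 * int i + 1))) =
      (\<Prod>i<m. e_fun (1 / 4 - of_real (t i) / 2) * of_real (2 * sin (pi * t i)))"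
    unfolding one_minus_e_fun[symmetric] ec_def
    by (intro prod.cong refl) (simp add: t_def minus_divide_left)
  also have "\<dots> = e_fun (\<Sum>i<m. 1 / 4 - of_real (t i) / 2) * of_real ?P"
    by (simp add: prod.distrib e_fun_sum)
  also have "(\<Sum>i<m. 1 / 4 - complex_of_real (t i) / 2) =
      of_nat m / 4 - (\<Sum>i<m. 2 * complex_of_nat i + 1) / (2 * of_int c)"
    by (simp add: sum_subtractf t_def sum_divide_distrib mult.commute)
  finally show "(\<Prod>i<m. 1 - ec c (- (2 * int i + 1))) =
      e_fun (of_nat m / 4 - of_nat (m\<^sup>2) / (2 * of_int c)) * of_real ?P"
    unfolding sum_odd .
qed

text \<open>Replacing \<open>x\<close> by \<open>x + y\<close> in the double sum makes the exponent
  linear in \<open>y\<close>, so only \<open>x = 0\<close> survives. The absolute value later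
  identifies the positive factor that the product formula leaves undetermined.\<close>

lemma norm_gauss_sum:
  assumes c: "c > 0" and odd: "odd c" and b: "coprime b c"
  shows "norm (gauss_sum b c) = sqrt (of_int c)"
proof -
  let ?I = "{0..<c}"
  have "complex_of_real ((norm (gauss_sum b c))\<^sup>2) = gauss_sum b c * cnj (gauss_sum b c)"
    by (rule complex_norm_square)
  also have "\<dots> = (\<Sum>y\<in>?I. \<Sum>x\<in>?I. ec c (b * x\<^sup>2 - b * y\<^sup>2))"
    unfolding gauss_sum_def by (simp add: sum_product ec_mult_cnj) (rule sum.swap)
  also have "\<dots> = (\<Sum>y\<in>?I. \<Sum>x\<in>?I. ec c (b * (1 * x + y)\<^sup>2 - b * y\<^sup>2))"
    using c by (intro sum.cong refl sum_affine_mod[symmetric] ec_cong cong_diff cong_mult cong_pow) auto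
  also have "\<dots> = (\<Sum>x\<in>?I. ec c (b * x\<^sup>2) * (\<Sum>y\<in>?I. ec c (2 * b * x * y)))"
    by (subst sum.swap, intro sum.cong refl)
       (simp add: sum_distrib_left power2_eq_square algebra_simps flip: ec_add)
  also have "\<dots> = (\<Sum>x\<in>?I. if x = 0 then of_int c else 0)"
  proof (intro sum.cong refl)
    fix x assume x: "x \<in> ?I"
    have "coprime (2 * b) c" using odd b by simp
    then have "c dvd 2 * b * x \<longleftrightarrow> c dvd x"
      by (simp add: coprime_commute coprime_dvd_mult_right_iff)
    also have "\<dots> \<longleftrightarrow> x = 0" using x zdvd_not_zless[of x c] by fastforce
    finally show "ec c (b * x\<^sup>2) * (\<Sum>y\<in>?I. ec c (2 * b * x * y)) = (if x = 0 then of_int c else 0)"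
      using c by (simp add: sum_ec)
  qed
  also have "\<dots> = complex_of_real (of_int c)" using c by simp
  finally have "(norm (gauss_sum b c))\<^sup>2 = of_int c"
    by (simp only: of_real_eq_iff)
  then show ?thesis by (metis norm_ge_zero real_sqrt_unique)
qed

lemma gauss_sum_two:
  assumes c: "c > 0" and odd: "odd c"
  shows "gauss_sum 2 c = of_real (sqrt (of_int c)) * e_fun (of_int (1 - c) / 8)"
proof -
  obtain k where k: "c = 2 * k + 1" using odd by (elim oddE)
  define m where "m = nat k"
  have cm: "c = 2 * int m + 1" using c k by (simp add: m_def)
  \<comment> \<open>\<open>h\<close> is the inverse of 2 modulo \<open>c\<close>.\<close>
  define h where "h = int m + 1"
  have h: "2 * h = c + 1" by (simp add: h_def cm)
  have cop: "coprime h c"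
  proof (rule coprimeI)
    fix d assume "d dvd h" "d dvd c"
    then have "d dvd 2 * h - c" by (intro dvd_diff) auto
    then show "is_unit d" by (simp add: h)
  qed
  have e8: "8 dvd 1 - c\<^sup>2"
  proof -
    have "8 * (k * (k + 1) div 2) = 4 * (k * (k + 1))" by simp
    also have "\<dots> = c\<^sup>2 - 1" by (simp add: k power2_eq_square algebra_simps)
    finally have "8 dvd c\<^sup>2 - 1" by (metis dvd_triv_left)
    then show ?thesis by (subst dvd_diff_commute)
  qed
  \<comment> \<open>\<open>r\<close> represents 1/8 modulo \<open>c\<close>. With this
    representative the phases add up to \<open>(1 - c) / 8\<close> exactly and not merely modulo
    1.\<close>
  define r where "r = (1 - c\<^sup>2) div 8"
  have r: "8 * r = 1 - c\<^sup>2" using e8 by (simp add: r_def)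
  \<comment> \<open>The argument \<open>h * j + h * h\<close> is \<open>(2 j + 1) / 4\<close> modulo
    \<open>c\<close>; twice its square is \<open>(2 j + 1)^2 / 8\<close>. The congruence is checked
    after multiplication by the unit 8.\<close>
  have e: "[2 * (h * j + h * h)\<^sup>2 = j * (j + 1) div 2 + r] (mod c)" for j
  proof -
    have cop8: "coprime 8 c"
      using odd coprime_power_left_iff[of 2 3 c] by simp
    have t8: "[4 * (2 * t) + 1 = 8 * (t + r)] (mod c)" for t
      by (simp add: r cong_iff_dvd_diff distrib_left)
    have d2: "2 * (j * (j + 1) div 2) = j * (j + 1)" by simp
    have "8 * (2 * (h * j + h * h)\<^sup>2) = (2 * h)\<^sup>2 * (2 * j + 2 * h)\<^sup>2"
      by (simp add: power2_eq_square algebra_simps)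
    also have "[\<dots> = 1\<^sup>2 * (2 * j + 1)\<^sup>2] (mod c)"
      by (intro cong_mult cong_pow cong_add cong_refl) (auto simp: h cong_iff_dvd_diff)
    also have "1\<^sup>2 * (2 * j + 1)\<^sup>2 = 4 * (2 * (j * (j + 1) div 2)) + 1"
      unfolding d2 by (simp add: power2_eq_square algebra_simps)
    also have "[\<dots> = 8 * (j * (j + 1) div 2 + r)] (mod c)"
      by (rule t8)
    finally show ?thesis
      by (simp only: cong_mult_lcancel[OF cop8])
  qed
  have "gauss_sum 2 c = (\<Sum>x\<in>{0..<c}. ec c (2 * (h * x + h * h)\<^sup>2))"
    unfolding gauss_sum_def
    using c cop by (intro sum_affine_mod[symmetric] ec_cong cong_mult cong_pow) auto
  also have "\<dots> = (\<Sum>x\<in>{0..<c}. ec c (x * (x + 1) div 2)) * ec c r"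
    unfolding sum_distrib_right ec_add[symmetric] using e by (intro sum.cong refl ec_cong)
  finally have g: "gauss_sum 2 c = (\<Prod>i<m. 1 - ec c (- (2 * int i + 1))) * ec c r"
    unfolding cm theta_sum_eq_prod .
  obtain P where P: "P > 0" "(\<Prod>i<m. 1 - ec c (- (2 * int i + 1))) =
      e_fun (of_nat m / 4 - of_nat (m\<^sup>2) / (2 * of_int c)) * of_real P"
    using theta_prod_polar[of m] unfolding cm by blast
  have m: "complex_of_nat m = (of_int c - 1) / 2" by (simp add: cm)
  have c0: "complex_of_int c \<noteq> 0" using c by simp
  have r': "complex_of_int r = (1 - of_int c * of_int c) / 8"
    using arg_cong[OF r, of complex_of_int] by (simp add: power2_eq_square eq_divide_eq mult.commute)
  have phase: "of_nat m / 4 - of_nat (m\<^sup>2) / (2 * of_int c) + of_int r / of_int c =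
      complex_of_int (1 - c) / 8"
    unfolding of_nat_power m r' using c0 by (simp add: field_simps power2_eq_square)
  have "gauss_sum 2 c =
      e_fun (of_nat m / 4 - of_nat (m\<^sup>2) / (2 * of_int c) + of_int r / of_int c) * of_real P"
    unfolding g P(2) ec_def[of c r] e_fun_add by (simp only: mult_ac)
  then have g': "gauss_sum 2 c = e_fun (of_int (1 - c) / 8) * of_real P"
    unfolding phase .
  have "coprime 2 c" using odd by simp
  then have "sqrt (of_int c) = norm (e_fun (of_int (1 - c) / 8) * of_real P)"
    using norm_gauss_sum[OF c odd, of 2] unfolding g' by (simp only:)
  also have "\<dots> = P"
    using P(1) norm_e_fun_of_real[of "of_int (1 - c) / 8"] by (simp add: norm_mult)
  finally show ?thesis using g' by simp
qed

section \<open>Sums over residue classes of integer vectors\<close>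

text \<open>The carrier conditions belong to the relation, so that a summand has to respect it only
  on vectors of dimension \<open>n\<close>.\<close>

definition vcong :: "nat \<Rightarrow> int \<Rightarrow> int vec \<Rightarrow> int vec \<Rightarrow> bool" where
  "vcong n c v w \<longleftrightarrow>
     v \<in> carrier_vec n \<and> w \<in> carrier_vec n \<and> (\<forall>i<n. [v $ i = w $ i] (mod c))"

lemma box_vecs_carrier: "v \<in> box_vecs n c \<Longrightarrow> v \<in> carrier_vec n"
  by (simp add: box_vecs_def)

lemma vcong_box_vecs_eq: "vcong n c v w \<Longrightarrow> v \<in> box_vecs n c \<Longrightarrow> w \<in> box_vecs n c \<Longrightarrow> v = w"
  by (intro eq_vecI) (auto simp: vcong_def box_vecs_def cong_def)

lemma map_vec_mod_in_box: "v \<in> carrier_vec n \<Longrightarrow> c > 0 \<Longrightarrow> map_vec (\<lambda>x. x mod c) v \<in> box_vecs n c"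
  by (auto simp: box_vecs_def)

lemma vcong_map_vec_mod: "v \<in> carrier_vec n \<Longrightarrow> vcong n c v (map_vec (\<lambda>x. x mod c) v)"
  by (auto simp: vcong_def cong_def)

lemma vcong_sym: "vcong n c v w \<Longrightarrow> vcong n c w v"
  by (auto simp: vcong_def cong_sym_eq)

lemma vcong_trans: "vcong n c u v \<Longrightarrow> vcong n c v w \<Longrightarrow> vcong n c u w"
  by (auto simp: vcong_def intro: cong_trans)

lemma vcong_mult_mat_vec:
  assumes "A \<in> carrier_mat m n" "vcong n c v w"
  shows "vcong m c (A *\<^sub>v v) (A *\<^sub>v w)"
  using assms
  by (auto simp: vcong_def scalar_prod_def row_def intro!: cong_sum cong_mult)

text \<open>Multiplication by the adjugate replaces \<open>U\<close> by the scalar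
  \<open>det U\<close>, which is a unit modulo \<open>c\<close>.\<close>

lemma vcong_mult_mat_vec_cancel:
  assumes U: "U \<in> carrier_mat n n" and cop: "coprime (det U) c"
    and v: "v \<in> carrier_vec n" "w \<in> carrier_vec n"
    and eq: "vcong n c (U *\<^sub>v v) (U *\<^sub>v w)"
  shows "vcong n c v w"
proof -
  have adj: "adj_mat U *\<^sub>v (U *\<^sub>v x) = det U \<cdot>\<^sub>v x" if "x \<in> carrier_vec n" for x
    using adj_mat(1,3)[OF U] U that
    by (simp flip: assoc_mult_mat_vec) (intro eq_vecI, auto)
  have "vcong n c (det U \<cdot>\<^sub>v v) (det U \<cdot>\<^sub>v w)"
    using vcong_mult_mat_vec[OF adj_mat(1)[OF U] eq] by (simp add: adj v)
  then show ?thesis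
    using v cop by (auto simp: vcong_def cong_mult_lcancel)
qed

lemma card_box_vecs:
  assumes "c > 0"
  shows "card (box_vecs n c) = nat c ^ n"
proof -
  have "bij_betw (vec n) ({..<n} \<rightarrow>\<^sub>E {0..c - 1}) (box_vecs n c)"
  proof (rule bij_betw_byWitness[where f' = "\<lambda>v. restrict (($) v) {..<n}"])
    show "\<forall>f\<in>{..<n} \<rightarrow>\<^sub>E {0..c - 1}. restrict (($) (vec n f)) {..<n} = f"
      by (auto simp: fun_eq_iff PiE_def extensional_def)
  qed (auto simp: box_vecs_def PiE_def Pi_def intro!: eq_vecI)
  then have "card (box_vecs n c) = card ({..<n} \<rightarrow>\<^sub>E {0..c - 1})"
    by (simp add: bij_betw_same_card)
  also have "\<dots> = nat c ^ n"
    by (simp add: card_PiE)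
  finally show ?thesis .
qed

text \<open>As many pairwise incongruent vectors as there are residue classes form a complete
  residue system. Affine substitutions and the splittings of a composite modulus are
  instances.\<close>

lemma sum_box_vecs_reindex:
  assumes c: "c > 0" and I: "finite I" "card I = nat c ^ n"
    and g: "\<And>i. i \<in> I \<Longrightarrow> g i \<in> carrier_vec n"
    and inj: "\<And>i j. i \<in> I \<Longrightarrow> j \<in> I \<Longrightarrow> vcong n c (g i) (g j) \<Longrightarrow> i = j"
    and f: "\<And>v w. vcong n c v w \<Longrightarrow> f v = f w"
  shows "(\<Sum>i\<in>I. f (g i)) = (\<Sum>v\<in>box_vecs n c. f v)"
proof -
  let ?h = "\<lambda>i. map_vec (\<lambda>x. x mod c) (g i)"
  have inj_h: "inj_on ?h I"
  proof (rule inj_onI)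
    fix i j assume ij: "i \<in> I" "j \<in> I" "?h i = ?h j"
    then show "i = j"
      using vcong_trans[OF vcong_map_vec_mod[of "g i" n c]] vcong_sym[OF vcong_map_vec_mod[of "g j" n c]]
        g inj by metis
  qed
  have img: "?h ` I = box_vecs n c"
    using c g I inj_h by (intro card_subset_eq finite_box_vecs)
      (auto simp: card_image card_box_vecs intro: map_vec_mod_in_box)
  have "(\<Sum>v\<in>box_vecs n c. f v) = (\<Sum>i\<in>I. f (?h i))"
    unfolding img[symmetric] by (simp add: sum.reindex[OF inj_h])
  also have "\<dots> = (\<Sum>i\<in>I. f (g i))"
    by (intro sum.cong refl f[OF vcong_sym] vcong_map_vec_mod g)
  finally show ?thesis by simp
qed

lemma sum_box_vecs_affine:
  assumes c: "c > 0" and U: "U \<in> carrier_mat n n" "coprime (det U) c" and s: "s \<in> carrier_vec n"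
    and f: "\<And>v w. vcong n c v w \<Longrightarrow> f v = f w"
  shows "(\<Sum>v\<in>box_vecs n c. f (U *\<^sub>v v + s)) = (\<Sum>v\<in>box_vecs n c. f v)"
proof (rule sum_box_vecs_reindex[OF c finite_box_vecs card_box_vecs[OF c] _ _ f])
  fix v w assume vw: "v \<in> box_vecs n c" "w \<in> box_vecs n c" "vcong n c (U *\<^sub>v v + s) (U *\<^sub>v w + s)"
  then have "vcong n c (U *\<^sub>v v) (U *\<^sub>v w)"
    using U s box_vecs_carrier by (auto simp: vcong_def cong_add_rcancel)
  then show "v = w"
    using vw U vcong_box_vecs_eq vcong_mult_mat_vec_cancel box_vecs_carrier by blast
qed (use U s box_vecs_carrier in auto)

lemma sum_box_vecs_append:
  "(\<Sum>v\<in>box_vecs (n + m) c. f v) = (\<Sum>v\<in>box_vecs n c. \<Sum>w\<in>box_vecs m c. f (v @\<^sub>v w))"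
proof -
  have "bij_betw (\<lambda>(v, w). v @\<^sub>v w) (box_vecs n c \<times> box_vecs m c) (box_vecs (n + m) c)"
  proof (rule bij_betw_byWitness[where f' = "\<lambda>v. (vec_first v n, vec_last v m)"])
    show "\<forall>p\<in>box_vecs n c \<times> box_vecs m c.
        (vec_first (case p of (v, w) \<Rightarrow> v @\<^sub>v w) n, vec_last (case p of (v, w) \<Rightarrow> v @\<^sub>v w) m) = p"
      by (auto simp: box_vecs_def vec_first_def vec_last_def intro!: eq_vecI)
    show "\<forall>v\<in>box_vecs (n + m) c. (case (vec_first v n, vec_last v m) of (v, w) \<Rightarrow> v @\<^sub>v w) = v"
      by (auto simp: box_vecs_def)
    show "(\<lambda>(v, w). v @\<^sub>v w) ` (box_vecs n c \<times> box_vecs m c) \<subseteq> box_vecs (n + m) c"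
      by (auto simp: box_vecs_def)
    show "(\<lambda>v. (vec_first v n, vec_last v m)) ` box_vecs (n + m) c \<subseteq> box_vecs n c \<times> box_vecs m c"
      by (auto simp: box_vecs_def vec_first_def vec_last_def)
  qed
  from sum.reindex_bij_betw[OF this, of f, symmetric] show ?thesis
    by (simp add: sum.cartesian_product case_prod_beta)
qed

text \<open>Injectivity is left as a hypothesis to cover two cases: the Chinese remainder splitting,
  where each coefficient is the other modulus, and the expansion of residues with
  \<open>\<alpha> = 1\<close> and \<open>\<beta> = c\<close>.\<close>

lemma sum_box_vecs_mult:
  assumes cd: "c > 0" "d > 0"
    and inj: "\<And>x x' y y'. x \<in> {0..<c} \<Longrightarrow> x' \<in> {0..<c} \<Longrightarrow> y \<in> {0..<d} \<Longrightarrow> y' \<in> {0..<d} \<Longrightarrow>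
      [\<alpha> * x + \<beta> * y = \<alpha> * x' + \<beta> * y'] (mod (c * d)) \<Longrightarrow> x = x' \<and> y = y'"
    and f: "\<And>v w. vcong n (c * d) v w \<Longrightarrow> f v = f w"
  shows "(\<Sum>v\<in>box_vecs n c. \<Sum>w\<in>box_vecs n d. f (\<alpha> \<cdot>\<^sub>v v + \<beta> \<cdot>\<^sub>v w)) =
    (\<Sum>v\<in>box_vecs n (c * d). f v)"
proof -
  have "(\<Sum>p\<in>box_vecs n c \<times> box_vecs n d. f (\<alpha> \<cdot>\<^sub>v fst p + \<beta> \<cdot>\<^sub>v snd p)) =
    (\<Sum>v\<in>box_vecs n (c * d). f v)"
  proof (rule sum_box_vecs_reindex)
    fix p assume "p \<in> box_vecs n c \<times> box_vecs n d"
    then show "\<alpha> \<cdot>\<^sub>v fst p + \<beta> \<cdot>\<^sub>v snd p \<in> carrier_vec n"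
      by (auto simp: box_vecs_def)
  next
    fix p q assume pq: "p \<in> box_vecs n c \<times> box_vecs n d" "q \<in> box_vecs n c \<times> box_vecs n d"
      "vcong n (c * d) (\<alpha> \<cdot>\<^sub>v fst p + \<beta> \<cdot>\<^sub>v snd p) (\<alpha> \<cdot>\<^sub>v fst q + \<beta> \<cdot>\<^sub>v snd q)"
    have "fst p $ i = fst q $ i \<and> snd p $ i = snd q $ i" if "i < n" for i
      using pq that by (intro inj) (auto simp: vcong_def box_vecs_def)
    then have "fst p = fst q" "snd p = snd q"
      using pq by (auto simp: box_vecs_def intro!: eq_vecI)
    then show "p = q" by (rule prod_eqI)
  qed (use cd f in \<open>auto simp: card_cartesian_product card_box_vecs nat_mult_distrib
        power_mult_distrib finite_box_vecs\<close>)
  then show ?thesis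
    by (simp add: sum.cartesian_product case_prod_beta)
qed

lemma scalar_prod_cong:
  assumes "u \<in> carrier_vec n" "vcong n c v w"
  shows "[u \<bullet> v = u \<bullet> w] (mod c)"
  using assms by (auto simp: scalar_prod_def vcong_def intro!: cong_sum cong_mult)

lemma sum_box_vecs_ec:
  assumes c: "c > 0" and u: "u \<in> carrier_vec n"
  shows "(\<Sum>v\<in>box_vecs n c. ec c (u \<bullet> v)) = (if \<forall>i<n. c dvd u $ i then of_int c ^ n else 0)"
proof (cases "\<forall>i<n. c dvd u $ i")
  case True
  then have "c dvd u \<bullet> v" if "v \<in> box_vecs n c" for v
    using u box_vecs_carrier[OF that] by (auto simp: scalar_prod_def intro!: dvd_sum)
  then show ?thesis
    using True c by (simp add: ec_dvd card_box_vecs of_nat_nat)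
next
  case False
  then obtain i where i: "i < n" "\<not> c dvd u $ i" by blast
  let ?S = "\<Sum>v\<in>box_vecs n c. ec c (u \<bullet> v)"
  have "?S = (\<Sum>v\<in>box_vecs n c. ec c (u \<bullet> (1\<^sub>m n *\<^sub>v v + unit_vec n i)))"
    using c u by (intro sum_box_vecs_affine[symmetric] ec_cong scalar_prod_cong) auto
  also have "\<dots> = (\<Sum>v\<in>box_vecs n c. ec c (u \<bullet> v) * ec c (u $ i))"
    using u i box_vecs_carrier
    by (intro sum.cong refl) (simp add: scalar_prod_add_distrib[of _ n] ec_add)
  also have "\<dots> = ec c (u $ i) * ?S"
    by (simp add: sum_distrib_left mult.commute)
  finally have "(1 - ec c (u $ i)) * ?S = 0"
    by (simp add: algebra_simps)
  then show ?thesis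
    using False i c ec_eq_1_iff[of c "u $ i"] by simp
qed

lemma mult_mat_vec_smult:
  fixes A :: "'a :: comm_ring mat"
  assumes "A \<in> carrier_mat m n" "v \<in> carrier_vec n"
  shows "A *\<^sub>v (k \<cdot>\<^sub>v v) = k \<cdot>\<^sub>v (A *\<^sub>v v)"
  using assms by (intro eq_vecI) auto

lemma smult_mat_mult_vec:
  fixes A :: "'a :: comm_ring mat"
  assumes "A \<in> carrier_mat m n" "v \<in> carrier_vec n"
  shows "(k \<cdot>\<^sub>m A) *\<^sub>v v = k \<cdot>\<^sub>v (A *\<^sub>v v)"
  using assms by (intro eq_vecI) auto

section \<open>Even integral forms and their Gauss sums\<close>

definition even_sym :: "nat \<Rightarrow> int mat \<Rightarrow> bool" where
  "even_sym n G \<longleftrightarrow>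
     G \<in> carrier_mat n n \<and> transpose_mat G = G \<and> (\<forall>i<n. even (G $$ (i, i)))"

text \<open>For even symmetric matrices the division is exact, by \<open>two_half_form\<close>.
  Integral half values keep the modulus at \<open>c\<close> instead of \<open>2 c\<close>, so that
  the prime 2 needs no separate denominators.\<close>

definition half_form :: "int mat \<Rightarrow> int vec \<Rightarrow> int" where
  "half_form G v = (v \<bullet> (G *\<^sub>v v)) div 2"

text \<open>Off-diagonal terms occur in equal pairs.\<close>

lemma even_sum_symmetric:
  fixes s :: "nat \<Rightarrow> nat \<Rightarrow> int"
  assumes "\<And>i j. s i j = s j i" "\<And>i. i < n \<Longrightarrow> even (s i i)"
  shows "even (\<Sum>i<n. \<Sum>j<n. s i j)"
  using assms(2)
proof (induction n)
  case (Suc n)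
  have "(\<Sum>j<n. s n j) = (\<Sum>i<n. s i n)"
    by (intro sum.cong refl assms(1))
  then have "(\<Sum>i<Suc n. \<Sum>j<Suc n. s i j) = (\<Sum>i<n. \<Sum>j<n. s i j) + 2 * (\<Sum>i<n. s i n) + s n n"
    by (simp add: sum.distrib)
  then show ?case using Suc by (simp only:) simp
qed simp

lemma even_symD:
  assumes "even_sym n G"
  shows "G \<in> carrier_mat n n" "transpose_mat G = G" "\<And>i. i < n \<Longrightarrow> even (G $$ (i, i))"
    and even_sym_index: "\<And>i j. i < n \<Longrightarrow> j < n \<Longrightarrow> G $$ (i, j) = G $$ (j, i)"
proof -
  show "G \<in> carrier_mat n n" "transpose_mat G = G" "\<And>i. i < n \<Longrightarrow> even (G $$ (i, i))"
    using assms by (auto simp: even_sym_def)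
  then show "G $$ (i, j) = G $$ (j, i)" if "i < n" "j < n" for i j
    using that by (metis carrier_matD index_transpose_mat(1))
qed

lemma quadratic_form_sum:
  assumes "G \<in> carrier_mat n n" "v \<in> carrier_vec n" "w \<in> carrier_vec n"
  shows "v \<bullet> (G *\<^sub>v w) = (\<Sum>i<n. \<Sum>j<n. v $ i * G $$ (i, j) * w $ j)"
  using assms
  by (simp add: scalar_prod_def row_def sum_distrib_left mult.assoc atLeast0LessThan)

lemma two_half_form:
  assumes G: "even_sym n G" and v: "v \<in> carrier_vec n"
  shows "2 * half_form G v = v \<bullet> (G *\<^sub>v v)"
proof -
  \<comment> \<open>The guard makes the summand symmetric at all indices, as the parity lemma
    demands; matrix entries are symmetric only inside the range.\<close>
  have "even (\<Sum>i<n. \<Sum>j<n. if i < n \<and> j < n then v $ i * G $$ (i, j) * v $ j else 0)"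
    using even_sym_index[OF G] even_symD(3)[OF G] by (intro even_sum_symmetric) auto
  then show ?thesis
    using quadratic_form_sum[OF even_symD(1)[OF G] v v] by (simp add: half_form_def)
qed

lemma bilinear_commute:
  assumes G: "even_sym n G" and v: "v \<in> carrier_vec n" "w \<in> carrier_vec n"
  shows "v \<bullet> (G *\<^sub>v w) = w \<bullet> (G *\<^sub>v v)"
  using transpose_vec_mult_scalar[OF even_symD(1)[OF G] v(2,1)] even_symD(1,2)[OF G] v
  by (metis comm_scalar_prod mult_mat_vec_carrier)

lemma half_form_add:
  assumes G: "even_sym n G" and v: "v \<in> carrier_vec n" "w \<in> carrier_vec n"
  shows "half_form G (v + w) = half_form G v + v \<bullet> (G *\<^sub>v w) + half_form G w"
proof -
  note [simp] = even_symD(1)[OF G] v mult_mat_vec_carrier[of _ n n]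
  have "2 * half_form G (v + w) = 2 * (half_form G v + v \<bullet> (G *\<^sub>v w) + half_form G w)"
    unfolding distrib_left two_half_form[OF G v(1)] two_half_form[OF G v(2)]
      two_half_form[OF G add_carrier_vec[OF v]]
    by (simp add: mult_add_distrib_mat_vec[of _ n n] scalar_prod_add_distrib[of _ n]
        add_scalar_prod_distrib[of _ n] bilinear_commute[OF G v])
  then show ?thesis by simp
qed

lemma half_form_smult:
  assumes G: "even_sym n G" and v: "v \<in> carrier_vec n"
  shows "half_form G (k \<cdot>\<^sub>v v) = k\<^sup>2 * half_form G v"
proof -
  have "2 * half_form G (k \<cdot>\<^sub>v v) = k\<^sup>2 * (2 * half_form G v)"
    using v even_symD(1)[OF G]
    by (simp add: two_half_form[OF G] mult_mat_vec_smult[of G n n] power2_eq_square)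
  then show ?thesis by simp
qed

lemma vcongE:
  assumes "vcong n c v w"
  obtains t where "t \<in> carrier_vec n" "w = v + c \<cdot>\<^sub>v t"
proof
  show "vec n (\<lambda>i. (w $ i - v $ i) div c) \<in> carrier_vec n" by simp
  show "w = v + c \<cdot>\<^sub>v vec n (\<lambda>i. (w $ i - v $ i) div c)"
  proof (rule eq_vecI)
    fix i assume "i < dim_vec (v + c \<cdot>\<^sub>v vec n (\<lambda>i. (w $ i - v $ i) div c))"
    then have i: "i < n" by simp
    then have "c dvd w $ i - v $ i"
      using assms by (simp add: vcong_def cong_iff_dvd_diff dvd_diff_commute)
    then have "c * ((w $ i - v $ i) div c) = w $ i - v $ i"
      by (rule dvd_mult_div_cancel)
    then show "w $ i = (v + c \<cdot>\<^sub>v vec n (\<lambda>i. (w $ i - v $ i) div c)) $ i"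
      using i assms by (simp add: vcong_def)
  qed (use assms in \<open>simp add: vcong_def\<close>)
qed

text \<open>With \<open>w = v + c t\<close> the values differ by
  \<open>c v^T G t + c^2 half_form G t\<close>, so the period is \<open>c\<close> itself.\<close>

lemma half_form_cong:
  assumes G: "even_sym n G" and vw: "vcong n c v w"
  shows "[half_form G v = half_form G w] (mod c)"
proof -
  obtain t where t: "t \<in> carrier_vec n" "w = v + c \<cdot>\<^sub>v t" using vcongE[OF vw] .
  have "v \<in> carrier_vec n" using vw by (simp add: vcong_def)
  then show ?thesis
    using t even_symD(1)[OF G]
    by (simp add: half_form_add[OF G] half_form_smult[OF G] mult_mat_vec_smult[of G n n] cong_iff_dvd_diff
        power2_eq_square)
qed

text \<open>This is \<open>S(G, a, c)\<close>, with the modulus written before the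
  multiplier.\<close>

definition gsum :: "nat \<Rightarrow> int mat \<Rightarrow> int \<Rightarrow> int \<Rightarrow> complex" where
  "gsum n G c a = (\<Sum>v\<in>box_vecs n c. ec c (a * half_form G v))"

lemma gsum_basis_change:
  assumes c: "c > 0" and G: "even_sym n G" and U: "U \<in> carrier_mat n n" "coprime (det U) c"
  shows "gsum n (transpose_mat U * G * U) c a = gsum n G c a"
proof -
  have "half_form (transpose_mat U * G * U) v = half_form G (U *\<^sub>v v + 0\<^sub>v n)"
    if "v \<in> carrier_vec n" for v
    using that U(1) even_symD(1)[OF G] transpose_vec_mult_scalar[of "transpose_mat U" n n]
    by (simp add: half_form_def assoc_mult_mat_vec[of _ n n _ n])
  then have "gsum n (transpose_mat U * G * U) c a =
      (\<Sum>v\<in>box_vecs n c. ec c (a * half_form G (U *\<^sub>v v + 0\<^sub>v n)))"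
    unfolding gsum_def by (intro sum.cong refl) (simp add: box_vecs_carrier)
  also have "\<dots> = gsum n G c a"
    unfolding gsum_def
    by (intro sum_box_vecs_affine c U ec_cong cong_mult half_form_cong[OF G]) auto
  finally show ?thesis .
qed

lemma half_form_block:
  assumes A: "A \<in> carrier_mat n n" "even_sym n A" and B: "even_sym m B"
    and v: "v \<in> carrier_vec n" and w: "w \<in> carrier_vec m"
  shows "half_form (four_block_mat A (0\<^sub>m n m) (0\<^sub>m m n) B) (v @\<^sub>v w) = half_form A v + half_form B w"
proof -
  have "v \<bullet> (A *\<^sub>v v) + w \<bullet> (B *\<^sub>v w) = 2 * (half_form A v + half_form B w)"
    by (simp add: two_half_form[OF A(2) v] two_half_form[OF B w])
  then show ?thesis
    using A even_symD(1)[OF B] v w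
    unfolding half_form_def[of "four_block_mat _ _ _ _"]
    by (simp add: mult_mat_vec_split[of A n B m] scalar_prod_append[of _ n _ m])
qed

lemma gsum_block:
  assumes A: "even_sym n A" and B: "even_sym m B"
  shows "gsum (n + m) (four_block_mat A (0\<^sub>m n m) (0\<^sub>m m n) B) c a = gsum n A c a * gsum m B c a"
  unfolding gsum_def sum_box_vecs_append sum_product
  by (intro sum.cong refl)
    (simp add: half_form_block[OF even_symD(1)[OF A] A B] box_vecs_carrier distrib_left ec_add)

text \<open>Residues modulo \<open>b * c\<close> are written as \<open>c v + b w\<close>; the mixed
  term of the form is then a multiple of \<open>b * c\<close>, and the squares \<open>c^2\<close>
  and \<open>b^2\<close> each lose one factor against the denominator.\<close>

lemma gsum_mult:
  assumes bc: "b > 0" "c > 0" "coprime b c" and G: "even_sym n G"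
  shows "gsum n G (b * c) a = gsum n G b (a * c) * gsum n G c (a * b)"
proof -
  have "gsum n G (b * c) a = (\<Sum>v\<in>box_vecs n b. \<Sum>w\<in>box_vecs n c.
      ec (b * c) (a * half_form G (c \<cdot>\<^sub>v v + b \<cdot>\<^sub>v w)))"
    unfolding gsum_def
  proof (rule sum_box_vecs_mult[symmetric])
    fix x x' y y' assume x: "x \<in> {0..<b}" "x' \<in> {0..<b}" and y: "y \<in> {0..<c}" "y' \<in> {0..<c}"
      and eq: "[c * x + b * y = c * x' + b * y'] (mod (b * c))"
    have "[c * x + b * y = c * x' + b * y'] (mod b)" "[c * x + b * y = c * x' + b * y'] (mod c)"
      using eq by (auto intro: cong_modulus_mult cong_dvd_modulus)
    then have "[c * x = c * x'] (mod b)" "[b * y = b * y'] (mod c)"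
      by (simp_all add: cong_def)
    then have "[x = x'] (mod b)" "[y = y'] (mod c)"
      using bc(3) by (simp_all add: cong_mult_lcancel coprime_commute)
    then show "x = x' \<and> y = y'" using x y by (simp add: cong_def)
  qed (use bc in \<open>auto intro!: ec_cong cong_mult half_form_cong[OF G]\<close>)
  also have "\<dots> = (\<Sum>v\<in>box_vecs n b. \<Sum>w\<in>box_vecs n c.
      ec b (a * c * half_form G v) * ec c (a * b * half_form G w))"
  proof (intro sum.cong refl)
    fix v w assume "v \<in> box_vecs n b" "w \<in> box_vecs n c"
    then have [simp]: "v \<in> carrier_vec n" "w \<in> carrier_vec n" by (simp_all add: box_vecs_carrier)
    have "a * half_form G (c \<cdot>\<^sub>v v + b \<cdot>\<^sub>v w) =
      c * (a * c * half_form G v) + b * c * (a * (v \<bullet> (G *\<^sub>v w))) + b * (a * b * half_form G w)"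
      using even_symD(1)[OF G]
      by (simp add: half_form_add[OF G] half_form_smult[OF G] mult_mat_vec_smult[of G n n]
          power2_eq_square algebra_simps)
    then show "ec (b * c) (a * half_form G (c \<cdot>\<^sub>v v + b \<cdot>\<^sub>v w)) =
        ec b (a * c * half_form G v) * ec c (a * b * half_form G w)"
      using ec_scale[of c b] ec_scale[of b c] bc by (simp add: ec_add ec_dvd mult.commute[of b c])
  qed
  finally show ?thesis
    by (simp add: gsum_def sum_product)
qed

lemma box_vecs_multiples:
  assumes p: "p > 0"
  shows "{v \<in> box_vecs n (p * e). \<forall>i<n. p dvd v $ i} = (\<lambda>v. p \<cdot>\<^sub>v v) ` box_vecs n e"
proof (intro equalityI subsetI)
  fix v assume v: "v \<in> {v \<in> box_vecs n (p * e). \<forall>i<n. p dvd v $ i}"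
  have "0 \<le> v $ i div p \<and> v $ i div p \<le> e - 1" if "i < n" for i
  proof -
    have "p dvd v $ i" using v that by auto
    then obtain k where k: "v $ i = p * k" by (elim dvdE)
    then have "0 \<le> p * k" "p * k < p * e" using v that by (auto simp: box_vecs_def)
    then show ?thesis using p by (simp add: k zero_le_mult_iff)
  qed
  then have "vec n (\<lambda>i. v $ i div p) \<in> box_vecs n e"
    using v by (auto simp: box_vecs_def)
  moreover have "v = p \<cdot>\<^sub>v vec n (\<lambda>i. v $ i div p)"
    using v by (intro eq_vecI) (auto simp: box_vecs_def)
  ultimately show "v \<in> (\<lambda>v. p \<cdot>\<^sub>v v) ` box_vecs n e" by blast
next
  fix v assume "v \<in> (\<lambda>v. p \<cdot>\<^sub>v v) ` box_vecs n e"
  then obtain w where w: "w \<in> box_vecs n e" "v = p \<cdot>\<^sub>v w" by blast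
  have "0 \<le> p * w $ i \<and> p * w $ i \<le> p * e - 1" if "i < n" for i
  proof -
    have "0 \<le> w $ i" "w $ i < e" using w that by (auto simp: box_vecs_def)
    then show ?thesis using p mult_strict_left_mono[of "w $ i" e p] by simp
  qed
  then show "v \<in> {v \<in> box_vecs n (p * e). \<forall>i<n. p dvd v $ i}"
    using w by (auto simp: box_vecs_def)
qed

text \<open>Residues modulo \<open>p * p * e\<close> are written as \<open>v + p e w\<close>. The
  exponent is then linear in \<open>w\<close>, and the sum over \<open>w\<close> vanishes unless
  \<open>p\<close> divides \<open>a G v\<close>, that is, unless \<open>v = p v'\<close>; for those
  \<open>v\<close> the factor \<open>p^2\<close> cancels. As the half form is integral, this
  includes \<open>p = 2\<close>.\<close>

lemma gsum_square_factor:
  assumes pe: "p > 0" "e > 0" and G: "even_sym n G"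
    and cop: "coprime a p" "coprime (det G) p"
  shows "gsum n G (p * p * e) a = of_int p ^ n * gsum n G e a"
proof -
  note Gc = even_symD(1)[OF G]
  have assoc: "p * p * e = (p * e) * p" by simp
  have "gsum n G (p * p * e) a = (\<Sum>v\<in>box_vecs n (p * e). \<Sum>w\<in>box_vecs n p.
      ec (p * p * e) (a * half_form G (1 \<cdot>\<^sub>v v + (p * e) \<cdot>\<^sub>v w)))"
    unfolding gsum_def assoc
  proof (rule sum_box_vecs_mult[symmetric])
    fix x x' y y' assume x: "x \<in> {0..<p * e}" "x' \<in> {0..<p * e}" and y: "y \<in> {0..<p}" "y' \<in> {0..<p}"
      and eq: "[1 * x + p * e * y = 1 * x' + p * e * y'] (mod (p * e * p))"
    then have "[1 * x + p * e * y = 1 * x' + p * e * y'] (mod (p * e))"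
      by (auto intro: cong_modulus_mult)
    then have xx: "x = x'"
      using x by (simp add: cong_def)
    then have "[p * e * y = p * e * y'] (mod (p * e * p))"
      using eq by (simp add: cong_add_lcancel)
    then have "y = y'"
      using y pe by (simp add: cong_def)
    then show "x = x' \<and> y = y'" using xx by simp
  qed (use pe in \<open>auto intro!: ec_cong cong_mult half_form_cong[OF G]\<close>)
  also have "\<dots> = (\<Sum>v\<in>box_vecs n (p * e). ec (p * p * e) (a * half_form G v) *
      (\<Sum>w\<in>box_vecs n p. ec p ((a \<cdot>\<^sub>v (G *\<^sub>v v)) \<bullet> w)))"
    unfolding sum_distrib_left
  proof (intro sum.cong refl)
    fix v w assume "v \<in> box_vecs n (p * e)" "w \<in> box_vecs n p"
    then have [simp]: "v \<in> carrier_vec n" "w \<in> carrier_vec n" by (simp_all add: box_vecs_carrier)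
    have comm: "v \<bullet> (G *\<^sub>v w) = (G *\<^sub>v v) \<bullet> w"
      using bilinear_commute[OF G, of v w] comm_scalar_prod[of "G *\<^sub>v v" n w] Gc by simp
    have smult: "(a \<cdot>\<^sub>v (G *\<^sub>v v)) \<bullet> w = a * ((G *\<^sub>v v) \<bullet> w)"
      using Gc by (intro smult_scalar_prod_distrib[of _ n]) auto
    have "a * half_form G (1 \<cdot>\<^sub>v v + (p * e) \<cdot>\<^sub>v w) =
      a * half_form G v + (p * e) * ((a \<cdot>\<^sub>v (G *\<^sub>v v)) \<bullet> w) + p * p * e * (a * e * half_form G w)"
      using Gc
      by (simp add: half_form_add[OF G] half_form_smult[OF G] mult_mat_vec_smult[of G n n]
          power2_eq_square algebra_simps comm smult)
    moreover have "ec (p * p * e) ((p * e) * ((a \<cdot>\<^sub>v (G *\<^sub>v v)) \<bullet> w)) = ec p ((a \<cdot>\<^sub>v (G *\<^sub>v v)) \<bullet> w)"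
      using ec_scale[of "p * e" p "(a \<cdot>\<^sub>v (G *\<^sub>v v)) \<bullet> w"] pe by (simp add: mult_ac)
    ultimately show "ec (p * p * e) (a * half_form G (1 \<cdot>\<^sub>v v + (p * e) \<cdot>\<^sub>v w)) =
        ec (p * p * e) (a * half_form G v) * ec p ((a \<cdot>\<^sub>v (G *\<^sub>v v)) \<bullet> w)"
      by (simp only: ec_add ec_dvd dvd_triv_left mult_1_right)
  qed
  also have "\<dots> = (\<Sum>v\<in>box_vecs n (p * e).
      if \<forall>i<n. p dvd v $ i then ec (p * p * e) (a * half_form G v) * of_int p ^ n else 0)"
  proof (intro sum.cong refl)
    fix v assume "v \<in> box_vecs n (p * e)"
    then have v: "v \<in> carrier_vec n" by (simp add: box_vecs_carrier)
    \<comment> \<open>Both \<open>a\<close> and \<open>det G\<close> are units modulo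
      \<open>p\<close>, so \<open>a G v\<close> vanishes modulo \<open>p\<close> exactly when
      \<open>v\<close> does.\<close>
    have "(\<forall>i<n. p dvd (a \<cdot>\<^sub>v (G *\<^sub>v v)) $ i) \<longleftrightarrow> vcong n p (G *\<^sub>v v) (G *\<^sub>v 0\<^sub>v n)"
      using v Gc cop(1)
      by (auto simp: vcong_def cong_0_iff coprime_dvd_mult_right_iff coprime_commute)
    also have "\<dots> \<longleftrightarrow> vcong n p v (0\<^sub>v n)"
      using vcong_mult_mat_vec_cancel[OF Gc cop(2) v] vcong_mult_mat_vec[OF Gc] by auto
    also have "\<dots> \<longleftrightarrow> (\<forall>i<n. p dvd v $ i)"
      using v by (auto simp: vcong_def cong_0_iff)
    finally show "ec (p * p * e) (a * half_form G v) * (\<Sum>w\<in>box_vecs n p. ec p ((a \<cdot>\<^sub>v (G *\<^sub>v v)) \<bullet> w)) =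
        (if \<forall>i<n. p dvd v $ i then ec (p * p * e) (a * half_form G v) * of_int p ^ n else 0)"
      using v Gc pe by (subst sum_box_vecs_ec) auto
  qed
  also have "\<dots> = (\<Sum>v\<in>{v \<in> box_vecs n (p * e). \<forall>i<n. p dvd v $ i}.
      ec (p * p * e) (a * half_form G v) * of_int p ^ n)"
    by (intro sum.inter_filter[symmetric] finite_box_vecs)
  also have "\<dots> = (\<Sum>v\<in>box_vecs n e. ec (p * p * e) (a * half_form G (p \<cdot>\<^sub>v v)) * of_int p ^ n)"
    unfolding box_vecs_multiples[OF pe(1)]
  proof (subst sum.reindex)
    show "inj_on (\<lambda>v. p \<cdot>\<^sub>v v) (box_vecs n e)"
    proof (rule inj_onI)
      fix v w assume vw: "v \<in> box_vecs n e" "w \<in> box_vecs n e" "p \<cdot>\<^sub>v v = p \<cdot>\<^sub>v w"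
      have "p * v $ i = p * w $ i" if "i < n" for i
        using arg_cong[OF vw(3), of "\<lambda>v. v $ i"] vw(1,2) that by (auto simp: box_vecs_def)
      then show "v = w"
        using vw pe by (intro eq_vecI) (auto simp: box_vecs_def)
    qed
  qed simp
  also have "\<dots> = (\<Sum>v\<in>box_vecs n e. ec e (a * half_form G v) * of_int p ^ n)"
  proof (intro sum.cong refl arg_cong2[of _ _ _ _ "(*)"])
    fix v assume "v \<in> box_vecs n e"
    then show "ec (p * p * e) (a * half_form G (p \<cdot>\<^sub>v v)) = ec e (a * half_form G v)"
      using ec_scale[of "p * p" e "a * half_form G v"] pe
      by (simp add: half_form_smult[OF G] box_vecs_carrier power2_eq_square mult_ac)
  qed
  finally show ?thesis
    by (simp add: gsum_def sum_distrib_left mult.commute)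
qed

section \<open>Odd prime moduli\<close>

text \<open>The squares of \<open>1..m\<close> together with their multiples by \<open>d\<close>
  meet every nonzero residue once: \<open>x^2 = y^2\<close> forces \<open>x = y\<close> or
  \<open>x = - y\<close>, and \<open>x^2 = d y^2\<close> would make \<open>d\<close> a square. The
  symmetry between \<open>x\<close> and \<open>p - x\<close> supplies the factor 2, and 0 is hit
  once by each sum.\<close>

lemma gauss_sum_add_nonresidue:
  fixes f :: "int \<Rightarrow> complex"
  assumes p: "prime p" "odd p" and d: "\<not> QuadRes p d" "\<not> p dvd d"
    and f: "\<And>x y. [x = y] (mod p) \<Longrightarrow> f x = f y"
  shows "(\<Sum>x\<in>{0..<p}. f (x\<^sup>2)) + (\<Sum>x\<in>{0..<p}. f (d * x\<^sup>2)) = 2 * (\<Sum>x\<in>{0..<p}. f x)"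
proof -
  obtain m where pm: "p = 2 * m + 1" using p(2) by (elim oddE)
  have p0: "p > 0" using p(1) by (rule prime_gt_0_int)
  then have m: "m \<ge> 0" using pm by simp
  have fold: "(\<Sum>x\<in>{0..<p}. f (u * x\<^sup>2)) = f 0 + 2 * (\<Sum>x\<in>{1..m}. f (u * x\<^sup>2))" for u
  proof -
    have I: "{0..<p} = insert 0 ({1..m} \<union> {m + 1..2 * m})" using pm m by auto
    have "(\<Sum>x\<in>{m + 1..2 * m}. f (u * x\<^sup>2)) = (\<Sum>x\<in>{1..m}. f (u * x\<^sup>2))"
    proof (rule sum.reindex_bij_witness[of _ "\<lambda>x. p - x" "\<lambda>x. p - x"])
      fix x
      have "(p - x)\<^sup>2 - x\<^sup>2 = p * (p - 2 * x)" by (simp add: power2_eq_square algebra_simps)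
      then have "[u * (p - x)\<^sup>2 = u * x\<^sup>2] (mod p)"
        by (intro cong_mult cong_refl) (simp add: cong_iff_dvd_diff)
      then show "f (u * (p - x)\<^sup>2) = f (u * x\<^sup>2)" by (rule f)
    qed (auto simp: pm)
    then show ?thesis
      unfolding I by (subst sum.insert, simp, simp, subst sum.union_disjoint) auto
  qed
  let ?J = "{1..m} \<times> {1, d}" and ?h = "\<lambda>(x, u). (u * x\<^sup>2) mod p"
  have d1: "d \<noteq> 1"
    using d(1) by (auto simp: QuadRes_def dest: spec[of _ 1])
  have ndvd: "\<not> p dvd x" if "x \<in> {1..m}" for x
    using that pm zdvd_not_zless[of x p] by auto
  have sq: "x = y" if "x \<in> {1..m}" "y \<in> {1..m}" "u \<in> {1, d}" "p dvd u * x\<^sup>2 - u * y\<^sup>2" for x y u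
  proof -
    have "\<not> p dvd u" using that(3) d(2) p(1) by auto
    moreover have "u * x\<^sup>2 - u * y\<^sup>2 = u * ((x - y) * (x + y))"
      by (simp add: power2_eq_square algebra_simps)
    ultimately have "p dvd x - y \<or> p dvd x + y"
      using that(4) p(1) by (metis prime_dvd_multD)
    moreover have "\<not> p dvd x + y"
      using that(1,2) pm zdvd_not_zless[of "x + y" p] by auto
    ultimately have "[x = y] (mod p)" by (simp add: cong_iff_dvd_diff)
    then show ?thesis using that(1,2) pm by (simp add: cong_def)
  qed
  have nonres: False if "x \<in> {1..m}" "y \<in> {1..m}" "p dvd x\<^sup>2 - d * y\<^sup>2" for x y
  proof -
    have "coprime y p"
      using ndvd[OF that(2)] p(1) by (simp add: prime_imp_coprime coprime_commute)
    then obtain z where z: "[y * z = 1] (mod p)"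
      using cong_solve_coprime_int by blast
    have "[(x * z)\<^sup>2 = x\<^sup>2 * z\<^sup>2] (mod p)" by (simp add: power_mult_distrib)
    also have "[x\<^sup>2 * z\<^sup>2 = d * y\<^sup>2 * z\<^sup>2] (mod p)"
      using that(3) by (intro cong_mult cong_refl) (simp add: cong_iff_dvd_diff)
    also have "d * y\<^sup>2 * z\<^sup>2 = d * (y * z)\<^sup>2" by (simp add: power_mult_distrib)
    also have "[\<dots> = d * 1\<^sup>2] (mod p)" by (intro cong_mult cong_pow cong_refl z)
    finally have "[(x * z)\<^sup>2 = d] (mod p)" by simp
    then show False using d(1) by (auto simp: QuadRes_def)
  qed
  have inj: "inj_on ?h ?J"
  proof (rule inj_onI)
    fix s t assume st: "s \<in> ?J" "t \<in> ?J" "?h s = ?h t"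
    obtain x u y v where xy: "s = (x, u)" "t = (y, v)" by (metis surj_pair)
    have "p dvd u * x\<^sup>2 - v * y\<^sup>2" "p dvd v * y\<^sup>2 - u * x\<^sup>2"
      using st(3) by (auto simp: xy mod_eq_dvd_iff dvd_diff_commute)
    then show "s = t" using st(1,2) sq[of x y u] nonres[of x y] nonres[of y x] by (auto simp: xy)
  qed
  have "?h ` ?J = {1..<p}"
  proof (rule card_subset_eq)
    show "?h ` ?J \<subseteq> {1..<p}"
    proof clarsimp
      fix x u assume xu: "1 \<le> x" "x \<le> m" "u = 1 \<or> u = d"
      then have "\<not> p dvd u * x\<^sup>2"
        using ndvd[of x] d(2) p(1) by (auto simp: prime_dvd_mult_iff prime_dvd_power_iff)
      then have "u * x\<^sup>2 mod p \<noteq> 0" by (simp add: dvd_eq_mod_eq_0)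
      moreover have "0 \<le> u * x\<^sup>2 mod p" "u * x\<^sup>2 mod p < p" using p0 by simp_all
      ultimately show "1 \<le> u * x\<^sup>2 mod p \<and> u * x\<^sup>2 mod p < p" by simp
    qed
    show "card (?h ` ?J) = card {1..<p}"
      unfolding card_image[OF inj] using d1 m pm by (simp add: card_cartesian_product)
  qed simp
  then have "(\<Sum>x\<in>{1..<p}. f x) = (\<Sum>s\<in>?J. f (?h s))"
    using sum.reindex[OF inj, of f] by simp
  also have "\<dots> = (\<Sum>s\<in>?J. f (snd s * (fst s)\<^sup>2))"
    by (intro sum.cong refl f) (auto simp: cong_def)
  also have "\<dots> = (\<Sum>x\<in>{1..m}. \<Sum>u\<in>{1, d}. f (u * x\<^sup>2))"
    unfolding sum.cartesian_product by (simp add: case_prod_unfold)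
  also have "\<dots> = (\<Sum>x\<in>{1..m}. f (x\<^sup>2)) + (\<Sum>x\<in>{1..m}. f (d * x\<^sup>2))"
    using d1 by (simp add: sum.distrib)
  finally have S: "(\<Sum>x\<in>{1..<p}. f x) = (\<Sum>x\<in>{1..m}. f (x\<^sup>2)) + (\<Sum>x\<in>{1..m}. f (d * x\<^sup>2))" .
  have "{0..<p} = insert 0 {1..<p}" using p0 by auto
  then have "(\<Sum>x\<in>{0..<p}. f x) = f 0 + (\<Sum>x\<in>{1..<p}. f x)" by simp
  then show ?thesis
    using fold[of 1] fold[of d] S by simp
qed

lemma gauss_sum_cong: "[a = b] (mod c) \<Longrightarrow> gauss_sum a c = gauss_sum b c"
  unfolding gauss_sum_def by (intro sum.cong refl ec_cong cong_mult) auto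

lemma gauss_sum_mult_square:
  assumes "c > 0" "coprime u c"
  shows "gauss_sum (b * u\<^sup>2) c = gauss_sum b c"
proof -
  have "gauss_sum (b * u\<^sup>2) c = (\<Sum>x\<in>{0..<c}. ec c (b * (u * x + 0)\<^sup>2))"
    by (simp add: gauss_sum_def power_mult_distrib mult.assoc)
  also have "\<dots> = gauss_sum b c"
    unfolding gauss_sum_def by (intro sum_affine_mod assms ec_cong cong_mult cong_pow) auto
  finally show ?thesis .
qed

lemma Legendre_unit: "\<not> p dvd a \<Longrightarrow> Legendre a p = 1 \<or> Legendre a p = - 1"
  by (simp add: Legendre_def cong_0_iff)

text \<open>If \<open>d\<close> is a square \<open>s^2\<close>, the substitution
  \<open>s * x\<close> removes it. Otherwise the two Gauss sums add up to twice a complete sum of a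
  nontrivial additive character, which is 0.\<close>

lemma gauss_sum_Legendre:
  assumes p: "prime p" "odd p" and d: "\<not> p dvd d" and b: "\<not> p dvd b"
  shows "gauss_sum (b * d) p = of_int (Legendre d p) * gauss_sum b p"
proof (cases "QuadRes p d")
  case True
  then obtain s where s: "[s\<^sup>2 = d] (mod p)" by (auto simp: QuadRes_def)
  then have "\<not> p dvd s"
    using d cong_dvd_iff[OF s] by (auto simp: power2_eq_square)
  then have "coprime s p"
    using p(1) by (simp add: prime_imp_coprime coprime_commute)
  moreover have "gauss_sum (b * d) p = gauss_sum (b * s\<^sup>2) p"
    using s by (intro gauss_sum_cong cong_mult cong_sym[OF s]) auto
  ultimately show ?thesis
    using True d p(1) gauss_sum_mult_square[of p s b]
    by (simp add: Legendre_def cong_0_iff prime_gt_0_int)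
next
  case False
  have "gauss_sum b p + gauss_sum (b * d) p = 2 * (\<Sum>x\<in>{0..<p}. ec p (b * x))"
    using gauss_sum_add_nonresidue[OF p False d, of "\<lambda>x. ec p (b * x)"]
    by (simp add: gauss_sum_def mult.assoc ec_cong cong_mult)
  also have "\<dots> = 0"
    using p(1) b by (simp add: sum_ec prime_gt_0_int)
  finally have "gauss_sum (b * d) p = - gauss_sum b p"
    by (simp add: eq_neg_iff_add_eq_0 add.commute)
  then show ?thesis
    using False d by (simp add: Legendre_def cong_0_iff)
qed

text \<open>Extracting \<open>d * e\<close> from a Gauss sum at once or in two stages must give the
  same result, and \<open>gauss_sum 1 p\<close> is nonzero by its absolute value.\<close>

lemma Legendre_mult:
  assumes p: "prime p" "odd p" and d: "\<not> p dvd d" "\<not> p dvd e"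
  shows "Legendre (d * e) p = Legendre d p * Legendre e p"
proof -
  have p1: "\<not> p dvd 1" "coprime 1 p" using p(1) by auto
  have de: "\<not> p dvd d * e" using d p(1) by (simp add: prime_dvd_mult_iff)
  have g: "gauss_sum 1 p \<noteq> 0"
    using norm_gauss_sum[of p 1] p prime_gt_0_int[of p] by auto
  have "of_int (Legendre (d * e) p) * gauss_sum 1 p = gauss_sum (d * e) p"
    using gauss_sum_Legendre[OF p de p1(1)] by simp
  also have "\<dots> = of_int (Legendre d p * Legendre e p) * gauss_sum 1 p"
    using gauss_sum_Legendre[OF p d(2,1)] gauss_sum_Legendre[OF p d(1) p1(1)] by simp
  finally show ?thesis
    using g by (auto simp only: mult_cancel_right of_int_eq_iff)
qed

section \<open>Change of basis and elimination of pivot blocks\<close>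

lemma transpose_smult_mat: "transpose_mat (k \<cdot>\<^sub>m A) = k \<cdot>\<^sub>m transpose_mat A"
  by (intro eq_matI) auto

lemma even_sym_basis_change:
  assumes G: "even_sym n G" and U: "U \<in> carrier_mat n n"
  shows "even_sym n (transpose_mat U * G * U)"
    and "\<And>i j. i < n \<Longrightarrow> j < n \<Longrightarrow> (transpose_mat U * G * U) $$ (i, j) = col U i \<bullet> (G *\<^sub>v col U j)"
    and "det (transpose_mat U * G * U) = det U ^ 2 * det G"
proof -
  note Gc = even_symD(1)[OF G]
  have assoc: "transpose_mat U * G * U = transpose_mat U * (G * U)"
    using U Gc by (simp add: assoc_mult_mat[of _ n n _ n _ n])
  show index: "(transpose_mat U * G * U) $$ (i, j) = col U i \<bullet> (G *\<^sub>v col U j)"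
    if "i < n" "j < n" for i j
    using that U Gc unfolding assoc by (simp add: col_mult2[of _ n n])
  have "transpose_mat (transpose_mat U * G * U) = transpose_mat U * G * U"
    unfolding assoc using U Gc even_symD(2)[OF G]
    by (subst transpose_mult[of _ n n _ n], simp, simp, subst transpose_mult[of _ n n _ n])
       (simp_all add: assoc_mult_mat[of _ n n _ n _ n])
  moreover have "even ((transpose_mat U * G * U) $$ (i, i))" if "i < n" for i
    unfolding index[OF that that] using two_half_form[OF G, of "col U i"] U
    by (metis col_dim carrier_matD(1) dvd_triv_left)
  ultimately show "even_sym n (transpose_mat U * G * U)"
    using U Gc by (auto simp: even_sym_def)
  show "det (transpose_mat U * G * U) = det U ^ 2 * det G"
    using U Gc by (simp add: det_mult[of _ n] det_transpose power2_eq_square)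
qed

text \<open>Block Gaussian elimination over the integers: scaling by \<open>det B\<close> avoids inverting the pivot
  block \<open>B\<close>.\<close>

lemma split_off_block:
  assumes G: "even_sym (r + m) G"
  defines "B \<equiv> mat r r (\<lambda>ij. G $$ ij)"
  obtains E where "even_sym r B" "even_sym m E" "(det B) ^ (2 * m) * det G = det B * det E"
    "\<And>c a. c > 0 \<Longrightarrow> coprime (det B) c \<Longrightarrow> gsum (r + m) G c a = gsum r B c a * gsum m E c a"
proof -
  note Gc = even_symD(1)[OF G]
  define C where "C = mat r m (\<lambda>(i, j). G $$ (i, r + j))"
  define D where "D = mat m m (\<lambda>(i, j). G $$ (r + i, r + j))"
  have B: "B \<in> carrier_mat r r" "transpose_mat B = B" and C: "C \<in> carrier_mat r m"
    and D: "D \<in> carrier_mat m m"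
    using even_sym_index[OF G] by (auto simp: B_def C_def D_def)
  have CT: "transpose_mat C \<in> carrier_mat m r" using C by simp
  have Bev: "even_sym r B"
    using B even_symD(3)[OF G] by (auto simp: even_sym_def B_def)
  have G_eq: "G = four_block_mat B C (transpose_mat C) D"
    using Gc even_sym_index[OF G] by (intro eq_matI) (auto simp: B_def C_def D_def)
  define d where "d = det B"
  define X where "X = adj_mat B * C"
  have X: "X \<in> carrier_mat r m" and adj: "adj_mat B \<in> carrier_mat r r"
    using adj_mat(1)[OF B(1)] C by (auto simp: X_def)
  \<comment> \<open>The upper right block of \<open>G * U\<close> is
    \<open>- B adj(B) C + d C\<close>, which vanishes because \<open>B adj(B)\<close> is
    \<open>d\<close> times the identity.\<close>
  define U where "U = four_block_mat (1\<^sub>m r) (- X) (0\<^sub>m m r) (d \<cdot>\<^sub>m 1\<^sub>m m)"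
  have U: "U \<in> carrier_mat (r + m) (r + m)" using X by (simp add: U_def)
  have BX: "B * X = d \<cdot>\<^sub>m C"
    using adj_mat(1,2)[OF B(1)] B C unfolding X_def
    by (subst assoc_mult_mat[symmetric, of _ r r _ r _ m]) (auto simp: d_def)
  have UR: "B * (- X) + C * (d \<cdot>\<^sub>m 1\<^sub>m m) = 0\<^sub>m r m"
    using B C X by (simp add: BX mult_smult_distrib[OF C one_carrier_mat])
  have LL: "transpose_mat (- X) * B + (d \<cdot>\<^sub>m 1\<^sub>m m) * transpose_mat C = 0\<^sub>m m r"
  proof -
    have X': "- X \<in> carrier_mat r m" using X by simp
    have "transpose_mat (B * (- X)) = transpose_mat (- X) * B"
      using transpose_mult[OF B(1) X'] by (simp only: B(2))
    moreover have "transpose_mat (C * (d \<cdot>\<^sub>m 1\<^sub>m m)) = (d \<cdot>\<^sub>m 1\<^sub>m m) * transpose_mat C"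
      using transpose_mult[OF C, of "d \<cdot>\<^sub>m 1\<^sub>m m" m] by (simp add: transpose_smult_mat)
    ultimately have "transpose_mat (- X) * B + (d \<cdot>\<^sub>m 1\<^sub>m m) * transpose_mat C =
        transpose_mat (B * (- X) + C * (d \<cdot>\<^sub>m 1\<^sub>m m))"
      using transpose_add[OF mult_carrier_mat[OF B(1) X'] mult_carrier_mat[OF C, of "d \<cdot>\<^sub>m 1\<^sub>m m" m]]
      by simp
    then show ?thesis unfolding UR by simp
  qed
  define F where "F = transpose_mat C * (- X) + D * (d \<cdot>\<^sub>m 1\<^sub>m m)"
  \<comment> \<open>Up to the vanishing first summand this is \<open>d (d D - C^T adj(B) C)\<close>,
    which is \<open>d^2\<close> times the Schur complement when \<open>d\<close> is nonzero. The
    zero product is kept so that \<open>E\<close> matches the block multiplication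
    literally.\<close>
  define E where "E = transpose_mat (- X) * 0\<^sub>m r m + (d \<cdot>\<^sub>m 1\<^sub>m m) * F"
  have F: "F \<in> carrier_mat m m" and E: "E \<in> carrier_mat m m"
    using C X D by (auto simp: F_def E_def)
  have GU: "G * U = four_block_mat B (0\<^sub>m r m) (transpose_mat C) F"
    unfolding G_eq U_def F_def
    using B C D X UR by (subst mult_four_block_mat[of _ r r _ m _ m _ _ r _ m]) auto
  have UT: "transpose_mat U = four_block_mat (1\<^sub>m r) (0\<^sub>m r m) (transpose_mat (- X)) (d \<cdot>\<^sub>m 1\<^sub>m m)"
    unfolding U_def using X by (subst transpose_four_block_mat[of _ r r _ m _ m]) (auto simp: transpose_smult_mat)
  have M: "transpose_mat U * G * U = four_block_mat B (0\<^sub>m r m) (0\<^sub>m m r) E"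
  proof -
    have "transpose_mat U * G * U = transpose_mat U * (G * U)"
      using U Gc by (simp add: assoc_mult_mat[of _ "r + m" "r + m" _ "r + m" _ "r + m"])
    also have "\<dots> = four_block_mat B (0\<^sub>m r m) (0\<^sub>m m r) E"
      unfolding GU UT
      using B C D X F LL by (subst mult_four_block_mat[of _ r r _ m _ m _ _ r _ m]) (auto simp: E_def)
    finally show ?thesis .
  qed
  note even_M = even_sym_basis_change(1)[OF G U, unfolded M]
  have ind: "E $$ (i, j) = four_block_mat B (0\<^sub>m r m) (0\<^sub>m m r) E $$ (r + i, r + j)"
    if "i < m" "j < m" for i j
    using that B E by simp
  have Eev: "even_sym m E"
    using E even_symD(3)[OF even_M] even_sym_index[OF even_M]
    by (auto simp: even_sym_def ind intro!: eq_matI)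
  have detU: "det U = d ^ m"
    unfolding U_def using X by (subst det_four_block_mat_lower_left_zero[of _ r _ m]) (auto simp: det_smult)
  \<comment> \<open>The extra factor \<open>d ^ (2 * m)\<close> is a square, so quadratic symbols
    will not see it and the symbols of \<open>d\<close> and \<open>det E\<close> multiply to that of
    \<open>det G\<close>.\<close>
  have "d ^ (2 * m) * det G = det (transpose_mat U * G * U)"
    using even_sym_basis_change(3)[OF G U] by (simp add: detU power_mult mult.commute)
  also have "\<dots> = d * det E"
    unfolding M d_def using B E by (subst det_four_block_mat_lower_left_zero[of _ r _ m]) auto
  finally have dets: "d ^ (2 * m) * det G = d * det E" .
  have "gsum (r + m) G c a = gsum r B c a * gsum m E c a" if "c > 0" "coprime (det B) c" for c a
    using gsum_basis_change[OF that(1) G U, of a] that(2) gsum_block[OF Bev Eev, of c a]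
    by (simp add: M detU d_def)
  then show ?thesis
    using that Bev Eev dets unfolding d_def by blast
qed

lemma gsum_0 [simp]: "gsum 0 G c a = 1"
proof -
  have "box_vecs 0 c = {0\<^sub>v 0}" by (auto simp: box_vecs_def)
  then show ?thesis by (simp add: gsum_def half_form_def scalar_prod_def)
qed

lemma sum_box_vecs_1: "(\<Sum>v\<in>box_vecs 1 c. f v) = (\<Sum>x\<in>{0..<c}. f (vec 1 (\<lambda>_. x)))"
  by (rule sum.reindex_bij_witness[of _ "\<lambda>x. vec 1 (\<lambda>_. x)" "\<lambda>v. v $ 0"])
     (auto simp: box_vecs_def intro!: eq_vecI arg_cong[of _ _ f])

lemma gsum_1:
  assumes "even_sym 1 A"
  shows "gsum 1 A c a = gauss_sum (a * (A $$ (0, 0) div 2)) c"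
proof -
  have hf: "half_form A (vec 1 (\<lambda>_. x)) = A $$ (0, 0) div 2 * x\<^sup>2" for x
    using two_half_form[OF assms, of "vec 1 (\<lambda>_. x)"] even_symD(1,3)[OF assms]
    by (auto simp: scalar_prod_def power2_eq_square elim!: evenE)
  then show ?thesis
    by (simp only: gsum_def gauss_sum_def sum_box_vecs_1 hf mult.assoc)
qed

lemma row_not_dvd_of_det:
  fixes G :: "int mat"
  assumes G: "G \<in> carrier_mat n n" and i: "i < n" and p: "\<not> p dvd det G"
  obtains j where "j < n" "\<not> p dvd G $$ (i, j)"
proof -
  have "\<exists>j<n. \<not> p dvd G $$ (i, j)"
  proof (rule ccontr)
    assume "\<not> (\<exists>j<n. \<not> p dvd G $$ (i, j))"
    then have "p dvd (\<Sum>j<n. G $$ (i, j) * cofactor G i j)"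
      by (intro dvd_sum) auto
    then show False
      using p laplace_expansion_row[OF G i] by simp
  qed
  then show ?thesis using that by blast
qed

lemma unit_vec_bilinear:
  fixes G :: "'a :: semiring_1 mat"
  assumes "G \<in> carrier_mat n n" "i < n" "j < n"
  shows "unit_vec n i \<bullet> (G *\<^sub>v unit_vec n j) = G $$ (i, j)"
  using assms scalar_prod_left_unit[of "G *\<^sub>v unit_vec n j" n i] by simp

text \<open>If \<open>p\<close> divides the entry (0, 0) but not (0, j), the form values at
  \<open>e_0 + e_j\<close> and \<open>e_0 - e_j\<close> differ by four times the latter entry. As
  \<open>p\<close> is odd, one of the two values is prime to \<open>p\<close>.\<close>

lemma exists_pivot:
  assumes G: "even_sym n G" and n: "n > 0" and p: "prime p" "odd p" "\<not> p dvd det G"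
  obtains U where "U \<in> carrier_mat n n" "det U = 1" "\<not> p dvd (transpose_mat U * G * U) $$ (0, 0)"
proof (cases "p dvd G $$ (0, 0)")
  case False
  then show ?thesis
    using that[of "1\<^sub>m n"] even_symD(1)[OF G] by simp
next
  case True
  note Gc = even_symD(1)[OF G]
  obtain j where j: "j < n" "\<not> p dvd G $$ (0, j)"
    using row_not_dvd_of_det[OF Gc n p(3)] .
  then have j0: "j \<noteq> 0" using True by metis
  let ?q = "\<lambda>t. G $$ (0, 0) + 2 * t * G $$ (0, j) + t\<^sup>2 * G $$ (j, j)"
  have index: "(transpose_mat (addrow_mat n t j 0) * G * addrow_mat n t j 0) $$ (0, 0) = ?q t" for t
  proof -
    let ?U = "addrow_mat n t j 0" and ?v = "unit_vec n 0 + t \<cdot>\<^sub>v unit_vec n j"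
    have col: "col ?U 0 = ?v"
      using n j(1) j0 by (intro eq_vecI) auto
    have cross: "unit_vec n 0 \<bullet> (G *\<^sub>v (t \<cdot>\<^sub>v unit_vec n j)) = t * G $$ (0, j)"
      using unit_vec_bilinear[OF Gc n j(1)] Gc n
      by (simp add: mult_mat_vec_smult[OF Gc] scalar_prod_smult_distrib[of _ n] del: index_mult_mat_vec)
    have "(transpose_mat ?U * G * ?U) $$ (0, 0) = ?v \<bullet> (G *\<^sub>v ?v)"
      using even_sym_basis_change(2)[OF G, of ?U 0 0] n by (simp only: col addrow_mat_carrier)
    also have "\<dots> = 2 * half_form G ?v"
      by (rule two_half_form[OF G, symmetric]) simp
    also have "\<dots> = 2 * half_form G (unit_vec n 0) + 2 * (t * G $$ (0, j))
        + t\<^sup>2 * (2 * half_form G (unit_vec n j))"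
      by (simp add: half_form_add[OF G] half_form_smult[OF G] cross)
    also have "\<dots> = ?q t"
      using n j(1) by (simp add: two_half_form[OF G] unit_vec_bilinear[OF Gc] del: index_mult_mat_vec)
    finally show ?thesis .
  qed
  have "\<not> p dvd ?q 1 \<or> \<not> p dvd ?q (- 1)"
  proof (rule ccontr)
    assume "\<not> ?thesis"
    then have "p dvd ?q 1 - ?q (- 1)" by (intro dvd_diff) auto
    then have "p dvd 4 * G $$ (0, j)" by simp
    then have "p dvd 2 ^ 2" using j p(1) by (simp add: prime_dvd_mult_iff)
    then have "p dvd 2" using p(1) prime_dvd_power by blast
    then show False using p(1,2) primes_dvd_imp_eq[of p 2] by auto
  qed
  then show ?thesis
    using that[of "addrow_mat n 1 j 0"] that[of "addrow_mat n (- 1) j 0"] det_addrow_mat[of j 0 n] j0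
    unfolding index by auto
qed

lemma gsum_odd_prime:
  assumes p: "prime p" "odd p" and a: "\<not> p dvd a"
  shows "even_sym n G \<Longrightarrow> \<not> p dvd det G \<Longrightarrow>
    gsum n G p a = of_int (Legendre (det G) p) * gauss_sum (2 * a) p ^ n"
proof (induction n arbitrary: G)
  case 0
  then have "G \<in> carrier_mat 0 0" by (simp add: even_sym_def)
  moreover have "QuadRes p 1" by (auto simp: QuadRes_def intro: exI[of _ 1])
  ultimately show ?case using prime_gt_1_int[OF p(1)] by (simp add: Legendre_def cong_0_iff)
next
  case (Suc n)
  have p0: "p > 0" using p(1) by (rule prime_gt_0_int)
  have not_dvd_2: "\<not> p dvd 2" using p primes_dvd_imp_eq[of p 2] by auto
  obtain U where U: "U \<in> carrier_mat (Suc n) (Suc n)" "det U = 1"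
      "\<not> p dvd (transpose_mat U * G * U) $$ (0, 0)"
    using exists_pivot[OF Suc.prems(1) _ p Suc.prems(2)] by blast
  define H where "H = transpose_mat U * G * U"
  have H: "even_sym (1 + n) H" "det H = det G" "\<not> p dvd H $$ (0, 0)"
    using even_sym_basis_change[OF Suc.prems(1) U(1)] U(2,3) by (auto simp: H_def)
  have gsum_H: "gsum (1 + n) H p a = gsum (Suc n) G p a"
    using gsum_basis_change[OF p0 Suc.prems(1) U(1)] U(2) by (simp add: H_def)
  define B where "B = mat 1 1 (\<lambda>ij. H $$ ij)"
  obtain E where E: "even_sym 1 B" "even_sym n E" "(det B) ^ (2 * n) * det H = det B * det E"
      "\<And>c a. c > 0 \<Longrightarrow> coprime (det B) c \<Longrightarrow> gsum (1 + n) H c a = gsum 1 B c a * gsum n E c a"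
    using split_off_block[OF H(1)] unfolding B_def by blast
  define d where "d = H $$ (0, 0)"
  have detB: "det B = d" by (simp add: det_single d_def B_def)
  have d: "\<not> p dvd d" "even d"
    using H(3) even_symD(3)[OF H(1), of 0] by (auto simp: d_def)
  have dn: "\<not> p dvd d ^ k" for k using d(1) p(1) prime_dvd_power by blast
  have dE: "d ^ (2 * n) * det G = d * det E" using E(3) by (simp only: detB H(2))
  moreover have "\<not> p dvd d ^ (2 * n) * det G"
    using dn Suc.prems(2) p(1) by (simp add: prime_dvd_mult_iff)
  ultimately have pE: "\<not> p dvd det E" by (metis dvd_mult)
  have "Legendre (d ^ (2 * n)) p = Legendre (d ^ n) p * Legendre (d ^ n) p"
    using Legendre_mult[OF p dn dn, of n n] by (simp add: mult_2 power_add)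
  then have "Legendre (d ^ (2 * n)) p = 1"
    using Legendre_unit[OF dn[of n]] by auto
  then have L: "Legendre d p * Legendre (det E) p = Legendre (det G) p"
    using Legendre_mult[OF p d(1) pE] Legendre_mult[OF p dn[of "2 * n"] Suc.prems(2)] dE by simp
  have "coprime d p"
    using prime_imp_coprime[OF p(1) d(1)] by (simp add: coprime_commute)
  then have "gsum (Suc n) G p a = gsum 1 B p a * gsum n E p a"
    using E(4)[OF p0, of a] by (simp only: detB gsum_H)
  also have "gsum 1 B p a = gauss_sum (a * (d div 2)) p"
    using gsum_1[OF E(1)] by (simp add: d_def B_def)
  \<comment> \<open>The square \<open>2^2\<close> turns \<open>d div 2\<close> into
    \<open>2 * d\<close>, so that the symbol of the pivot itself can be extracted.\<close>
  also have "\<dots> = gauss_sum (a * (d div 2) * 2\<^sup>2) p"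
    using p(2) by (intro gauss_sum_mult_square[symmetric] p0) simp
  also have "\<dots> = gauss_sum (2 * a * d) p"
    using d(2) by (auto elim!: evenE simp: mult_ac)
  also have "\<dots> = of_int (Legendre d p) * gauss_sum (2 * a) p"
    using a not_dvd_2 p(1) by (intro gauss_sum_Legendre p d(1)) (simp add: prime_dvd_mult_iff)
  also have "gsum n E p a = of_int (Legendre (det E) p) * gauss_sum (2 * a) p ^ n"
    by (rule Suc.IH[OF E(2) pE])
  finally show ?case
    by (simp add: mult_ac flip: L)
qed

section \<open>General moduli\<close>

lemma gsum_binary:
  assumes A: "even_sym 2 A"
  shows "gsum 2 A c a = (\<Sum>x\<in>{0..<c}. \<Sum>y\<in>{0..<c}.
    ec c (a * (A $$ (0, 0) div 2 * x\<^sup>2 + A $$ (0, 1) * x * y + A $$ (1, 1) div 2 * y\<^sup>2)))"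
proof -
  note Ac = even_symD(1)[OF A]
  have "even (A $$ (0, 0))" "even (A $$ (1, 1))"
    using even_symD(3)[OF A] by simp_all
  then obtain d e where de: "A $$ (0, 0) = 2 * d" "A $$ (1, 1) = 2 * e"
    unfolding dvd_def by blast
  have "half_form A (vec 1 (\<lambda>_. x) @\<^sub>v vec 1 (\<lambda>_. y)) = d * x\<^sup>2 + A $$ (0, 1) * x * y + e * y\<^sup>2" for x y
  proof -
    let ?v = "vec 1 (\<lambda>_. x) @\<^sub>v vec 1 (\<lambda>_. y)"
    have v: "?v \<in> carrier_vec 2" by (rule carrier_vecI) simp
    have two: "{..<2 :: nat} = {0, 1}" by auto
    have sym: "A $$ (1, 0) = A $$ (0, 1)"
      using even_sym_index[OF A, of 1 0] by simp
    have "2 * half_form A ?v = 2 * (d * x\<^sup>2 + A $$ (0, 1) * x * y + e * y\<^sup>2)"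
      unfolding two_half_form[OF A v] quadratic_form_sum[OF Ac v v] two
      by (simp add: de[unfolded One_nat_def] sym[unfolded One_nat_def] power2_eq_square algebra_simps)
    then show ?thesis by simp
  qed
  then show ?thesis
    using sum_box_vecs_append[of "\<lambda>v. ec c (a * half_form A v)" 1 1 c]
    by (simp add: gsum_def sum_box_vecs_1 de flip: One_nat_def)
qed

lemma kronecker_prime_2_cases:
  assumes "odd d"
  shows "kronecker_prime d 2 = (if d mod 8 = 1 \<or> d mod 8 = 7 then 1 else - 1)"
  using assms by (simp add: kronecker_prime_def)

lemma odd_mod_8: "odd (d :: int) \<Longrightarrow> d mod 8 \<in> {1, 3, 5, 7}"
  by (auto elim!: oddE) presburger

lemma kronecker_prime_2_mult:
  assumes "odd d" "odd e"
  shows "kronecker_prime (d * e) 2 = kronecker_prime d 2 * kronecker_prime e 2"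
proof -
  define r s where "r = d mod 8" and "s = e mod 8"
  have rs: "r \<in> {1, 3, 5, 7}" "s \<in> {1, 3, 5, 7}"
    using odd_mod_8 assms by (simp_all add: r_def s_def)
  have odd: "odd (d * e)" using assms by simp
  have "d * e mod 8 = r * s mod 8" by (simp add: r_def s_def mod_mult_eq)
  then show ?thesis
    using rs unfolding kronecker_prime_2_cases[OF assms(1)] kronecker_prime_2_cases[OF assms(2)]
      kronecker_prime_2_cases[OF odd] r_def[symmetric] s_def[symmetric]
    by auto
qed

lemma det_2x2:
  assumes A: "A \<in> carrier_mat 2 2"
  shows "det A = A $$ (0, 0) * A $$ (1, 1) - A $$ (0, 1) * A $$ (1, 0)"
proof -
  have two: "{..<2 :: nat} = {0, 1}" by auto
  have single: "det (mat_delete A 0 j) = A $$ (1, 1 - j)" if "j < 2" for j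
    using A that by (subst det_single) (auto simp: mat_delete_def less_Suc_eq numeral_2_eq_2)
  show ?thesis
    using laplace_expansion_row[OF A, of 0] single[of 0] single[of 1]
    unfolding two by (simp add: cofactor_def)
qed

text \<open>With diagonal \<open>2 d\<close>, \<open>2 e\<close> and off-diagonal entry
  \<open>2 k + 1\<close> the determinant is \<open>4 (d e - k (k + 1)) - 1\<close>. Since
  \<open>k (k + 1)\<close> is even, it is 7 or 3 modulo 8 according as \<open>d e\<close> is even or
  odd, and in these cases the four terms of the sum add up to 2 or -2.\<close>

lemma gsum_2_binary:
  assumes A: "even_sym 2 A" and odd: "odd (A $$ (0, 1))" "odd a"
  shows "odd (det A)" "gsum 2 A 2 a = 2 * of_int (kronecker_prime (det A) 2)"
proof -
  have "even (A $$ (0, 0))" "even (A $$ (1, 1))"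
    using even_symD(3)[OF A] by simp_all
  then obtain d e where de: "A $$ (0, 0) = 2 * d" "A $$ (1, 1) = 2 * e"
    unfolding dvd_def by blast
  obtain k where k: "A $$ (0, 1) = 2 * k + 1" using odd(1) by (elim oddE)
  have sym: "A $$ (1, 0) = A $$ (0, 1)"
    using even_sym_index[OF A, of 1 0] by simp
  have det: "det A = 4 * (d * e - k * (k + 1)) - 1"
    unfolding det_2x2[OF even_symD(1)[OF A]] sym de k by (simp add: algebra_simps)
  then show "odd (det A)" by simp
  have "even (k * (k + 1))" by simp
  then obtain l where l: "k * (k + 1) = 2 * l" by (elim evenE)
  have I: "{0..<2 :: int} = {0, 1}" by auto
  have ec2: "ec 2 (a * x) = (if even x then 1 else - 1)" for x
    using odd(2) by (simp add: ec_two)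
  have "gsum 2 A 2 a = 1 + (if even e then 1 else - 1) + (if even d then 1 else - 1)
      + (if even (d + e) then - 1 else 1)"
    unfolding gsum_binary[OF A] I by (simp add: ec2 de[unfolded One_nat_def] k[unfolded One_nat_def])
  also have "\<dots> = 2 * of_int (kronecker_prime (det A) 2)"
  proof (cases "even (d * e)")
    case True
    then obtain h where "d * e = 2 * h" by (elim evenE)
    then have "det A = 8 * (h - l - 1) + 7" unfolding det l by simp
    then have "det A mod 8 = 7" by presburger
    then show ?thesis
      using True \<open>odd (det A)\<close> by (auto simp: kronecker_prime_2_cases)
  next
    case False
    then obtain h where "d * e = 2 * h + 1" by (elim oddE)
    then have "det A = 8 * (h - l) + 3" unfolding det l by simp
    then have "det A mod 8 = 3" by presburger
    then show ?thesis
      using False \<open>odd (det A)\<close> by (auto simp: kronecker_prime_2_cases)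
  qed
  finally show "gsum 2 A 2 a = 2 * of_int (kronecker_prime (det A) 2)" .
qed

text \<open>All diagonal entries are even, so no block of size 1 is invertible modulo 2. An odd
  entry of row 0 is brought to position (0, 1) instead, by adding basis vector \<open>j\<close> to
  basis vector 1; the leading block of size 2 then has odd determinant.\<close>

lemma exists_even_pivot:
  assumes G: "even_sym n G" and n: "n > 0" and odd: "odd (det G)"
  obtains U where "n \<ge> 2" "U \<in> carrier_mat n n" "det U = 1"
    "odd ((transpose_mat U * G * U) $$ (0, 1))"
proof -
  note Gc = even_symD(1)[OF G]
  obtain j where j: "j < n" "odd (G $$ (0, j))"
    using row_not_dvd_of_det[OF Gc n] odd by metis
  then have j0: "j \<noteq> 0" using even_symD(3)[OF G n] by metis
  then have n2: "n \<ge> 2" using j(1) by simp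
  show ?thesis
  proof (cases "odd (G $$ (0, 1))")
    case True
    then show ?thesis
      using that[of "1\<^sub>m n"] n2 Gc by simp
  next
    case False
    then have j1: "j \<noteq> 1" using j by metis
    let ?U = "addrow_mat n 1 j 1 :: int mat"
    have col: "col ?U 0 = unit_vec n 0" "col ?U 1 = unit_vec n 1 + unit_vec n j"
      using n2 j(1) j0 j1 by (auto intro!: eq_vecI)
    have "(transpose_mat ?U * G * ?U) $$ (0, 1) = unit_vec n 0 \<bullet> (G *\<^sub>v (unit_vec n 1 + unit_vec n j))"
      using even_sym_basis_change(2)[OF G, of ?U 0 1] n2 by (simp only: col addrow_mat_carrier)
    also have "\<dots> = unit_vec n 0 \<bullet> (G *\<^sub>v unit_vec n 1) + unit_vec n 0 \<bullet> (G *\<^sub>v unit_vec n j)"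
      using Gc by (simp add: mult_add_distrib_mat_vec[OF Gc] scalar_prod_add_distrib[of _ n] del: index_mult_mat_vec)
    also have "\<dots> = G $$ (0, 1) + G $$ (0, j)"
      using n2 j(1) by (simp add: unit_vec_bilinear[OF Gc] del: index_mult_mat_vec)
    finally show ?thesis
      using that[of ?U] n2 False j(2) j1 by (simp add: det_addrow_mat)
  qed
qed

text \<open>The parity of \<open>n\<close> is part of the claim because it results from the same
  splitting into blocks of size 2 and is needed for every even modulus.\<close>

lemma gsum_2:
  assumes a: "odd a"
  shows "even_sym n G \<Longrightarrow> odd (det G) \<Longrightarrow>
    even n \<and> gsum n G 2 a = 2 ^ (n div 2) * of_int (kronecker_prime (det G) 2)"
proof (induction n arbitrary: G rule: less_induct)
  case (less n)
  show ?case
  proof (cases "n = 0")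
    case True
    then have "G \<in> carrier_mat 0 0" using less.prems(1) by (simp add: even_sym_def)
    then show ?thesis using True by (simp add: kronecker_prime_def)
  next
    case False
    obtain U where U: "n \<ge> 2" "U \<in> carrier_mat n n" "det U = 1"
      "odd ((transpose_mat U * G * U) $$ (0, 1))"
      using exists_even_pivot[OF less.prems(1) _ less.prems(2)] False by blast
    obtain m where m: "n = 2 + m" using U(1) le_Suc_ex by blast
    define H where "H = transpose_mat U * G * U"
    have H: "even_sym (2 + m) H" "det H = det G" "odd (H $$ (0, 1))"
      using even_sym_basis_change[OF less.prems(1) U(2)] U(3,4) by (auto simp: H_def m)
    have gsum_H: "gsum (2 + m) H 2 a = gsum n G 2 a"
      using gsum_basis_change[OF _ less.prems(1) U(2)] U(3) by (simp add: H_def m)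
    define B where "B = mat 2 2 (\<lambda>ij. H $$ ij)"
    obtain E where E: "even_sym 2 B" "even_sym m E" "(det B) ^ (2 * m) * det H = det B * det E"
        "\<And>c a. c > 0 \<Longrightarrow> coprime (det B) c \<Longrightarrow> gsum (2 + m) H c a = gsum 2 B c a * gsum m E c a"
      using split_off_block[OF H(1)] unfolding B_def by blast
    have "odd (B $$ (0, 1))" using H(3) by (simp add: B_def)
    note B = gsum_2_binary[OF E(1) this a]
    have dE: "det B ^ (2 * m) * det G = det B * det E" using E(3) by (simp only: H(2))
    have pow: "odd (det B ^ k)" for k using B(1) by simp
    have oddE: "odd (det E)"
      using dE B(1) less.prems(2) pow[of "2 * m"] by (metis even_mult_iff)
    have IH: "even m" "gsum m E 2 a = 2 ^ (m div 2) * of_int (kronecker_prime (det E) 2)"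
      using less.IH[OF _ E(2) oddE] m by simp_all
    have "kronecker_prime (det B ^ (2 * m)) 2 = kronecker_prime (det B ^ m) 2 * kronecker_prime (det B ^ m) 2"
      using kronecker_prime_2_mult[OF pow pow, of m m] by (simp add: mult_2 power_add)
    also have "\<dots> = 1"
      by (simp add: kronecker_prime_2_cases[OF pow])
    finally have k: "kronecker_prime (det B) 2 * kronecker_prime (det E) 2 = kronecker_prime (det G) 2"
      using kronecker_prime_2_mult[OF B(1) oddE] kronecker_prime_2_mult[OF pow less.prems(2), of "2 * m"] dE
      by simp
    have "gsum n G 2 a = gsum 2 B 2 a * gsum m E 2 a"
      using E(4)[of 2 a] B(1) gsum_H by simp
    also have "\<dots> = 2 ^ Suc (m div 2) * of_int (kronecker_prime (det B) 2 * kronecker_prime (det E) 2)"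
      by (simp add: B(2) IH(2))
    finally have "gsum n G 2 a = 2 ^ Suc (m div 2) * of_int (kronecker_prime (det G) 2)"
      unfolding k .
    then show ?thesis using IH(1) by (simp add: m)
  qed
qed

section \<open>Multiplicativity of the Kronecker symbol\<close>

lemma kronecker_1 [simp]: "kronecker m 1 = 1"
  by (simp add: kronecker_def)

lemma kronecker_prime_times:
  assumes "prime p" "d > 0"
  shows "kronecker m (p * d) = kronecker_prime m p * kronecker m d"
proof -
  have p: "p > 0" using assms(1) by (rule prime_gt_0_int)
  have "prime_factorization (p * d) = {#p#} + prime_factorization d"
    using assms p by (subst prime_factorization_mult) (auto simp: prime_factorization_prime)
  then show ?thesis
    using mult_pos_pos[OF p assms(2)] assms(2) by (auto simp: kronecker_def)
qed

lemma kronecker_prime_mult: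
  assumes "prime p" "\<not> p dvd m" "\<not> p dvd n"
  shows "kronecker_prime (m * n) p = kronecker_prime m p * kronecker_prime n p"
proof (cases "p = 2")
  case True
  then show ?thesis using assms kronecker_prime_2_mult[of m n] by simp
next
  case False
  then have "odd p" using assms(1) primes_dvd_imp_eq[of 2 p] by auto
  then show ?thesis using False assms Legendre_mult[of p m n] by (simp add: kronecker_prime_def)
qed

lemma kronecker_prime_unit:
  assumes "prime p" "\<not> p dvd m"
  shows "kronecker_prime m p * kronecker_prime m p = 1"
  using assms Legendre_unit[of p m] by (auto simp: kronecker_prime_def)

text \<open>The induction hypothesis reaches all smaller moduli, not only \<open>d\<close>, because
  removing a square factor passes from \<open>p * p * e\<close> to \<open>e\<close>.\<close>

lemma pos_int_prime_induct [consumes 1, case_names one times]: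
  fixes c :: int
  assumes "c > 0" "P 1" "\<And>p d. prime p \<Longrightarrow> d > 0 \<Longrightarrow> (\<And>e. 0 < e \<Longrightarrow> e < p * d \<Longrightarrow> P e) \<Longrightarrow> P (p * d)"
  shows "P c"
  using assms(1)
proof (induction "nat c" arbitrary: c rule: less_induct)
  case less
  show ?case
  proof (cases "c = 1")
    case False
    then obtain p where p: "prime p" "p dvd c"
      using prime_factor_int[of c] less.prems by auto
    then obtain d where d: "c = p * d" by (elim dvdE)
    have "p > 0" using p(1) by (rule prime_gt_0_int)
    then have "d > 0" using less.prems d by (simp add: zero_less_mult_iff)
    moreover have "P e" if "0 < e" "e < p * d" for e
      using less.hyps[of e] that d by simp
    ultimately show ?thesis using assms(3)[OF p(1)] d by simp
  qed (use assms(2) in simp)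
qed

lemma less_prime_mult: "prime p \<Longrightarrow> (d :: int) > 0 \<Longrightarrow> d < p * d"
  using prime_gt_1_int[of p] mult_strict_right_mono[of 1 p d] by simp

lemma kronecker_mult_left:
  assumes "c > 0" "coprime m c" "coprime n c"
  shows "kronecker (m * n) c = kronecker m c * kronecker n c"
  using assms
proof (induction c rule: pos_int_prime_induct)
  case (times p d)
  have "\<not> p dvd m" "\<not> p dvd n" "coprime m d" "coprime n d"
    using times.prems times.hyps(1) not_coprimeI[of p _ p] not_prime_unit by auto
  then show ?case
    using times.hyps times.IH[of d] less_prime_mult[of p d]
    by (simp add: kronecker_prime_times kronecker_prime_mult)
qed simp

lemma kronecker_square:
  assumes "c > 0" "coprime m c"
  shows "kronecker m c * kronecker m c = 1"
  using assms
proof (induction c rule: pos_int_prime_induct)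
  case (times p d)
  have m: "\<not> p dvd m" "coprime m d"
    using times.prems times.hyps(1) not_coprimeI[of p _ p] not_prime_unit by auto
  have "kronecker m (p * d) * kronecker m (p * d) =
      (kronecker_prime m p * kronecker_prime m p) * (kronecker m d * kronecker m d)"
    using times.hyps by (simp add: kronecker_prime_times)
  then show ?case
    using times.hyps times.IH[of d] less_prime_mult[of p d] m kronecker_prime_unit[OF times.hyps(1) m(1)]
    by simp
qed simp

lemma kronecker_even_power:
  assumes "c > 0" "coprime m c" "even n"
  shows "kronecker m c ^ n = 1"
  using assms kronecker_square[OF assms(1,2)]
  by (auto elim!: evenE simp: power_mult power2_eq_square)

section \<open>Evaluation for arbitrary moduli\<close>

lemma even_sym_single: "even_sym 1 (mat 1 1 (\<lambda>_. 2 * d))"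
  by (auto simp: even_sym_def)

lemma gsum_single: "gsum 1 (mat 1 1 (\<lambda>_. 2 * d)) c a = gauss_sum (a * d) c"
  using gsum_1[OF even_sym_single, of d c a] by simp

lemma det_single_mat: "det (mat 1 1 (\<lambda>_. d)) = d"
  by (simp add: det_single)

text \<open>The one-dimensional sum is \<open>gsum\<close> for the matrix \<open>(2)\<close>, so it
  inherits the general splitting.\<close>

lemma gauss_sum_times:
  assumes "b > 0" "c > 0" "coprime b c"
  shows "gauss_sum a (b * c) = gauss_sum (a * c) b * gauss_sum (a * b) c"
  using gsum_mult[OF assms even_sym_single[of 1], of a] unfolding gsum_single by simp

lemma gauss_sum_square_factor:
  assumes "p > 0" "e > 0" "odd p" "coprime a p"
  shows "gauss_sum a (p * p * e) = of_int p * gauss_sum a e"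
  using gsum_square_factor[OF assms(1,2) even_sym_single[of 1] assms(4)] assms(3)
  unfolding gsum_single det_single_mat by simp

lemma sum_box_vecs_modulus_1: "(\<Sum>v\<in>box_vecs n 1. f v) = f (0\<^sub>v n)"
proof -
  have "box_vecs n 1 = {0\<^sub>v n}"
    by (auto simp: box_vecs_def intro!: eq_vecI)
  then show ?thesis by simp
qed

text \<open>If \<open>p\<close> does not divide \<open>d\<close>, then \<open>gsum\<close> and
  \<open>gauss_sum\<close> split with the same twists \<open>a * d\<close> and \<open>a * p\<close>.
  If it does, both lose the square factor \<open>p^2\<close>, and the symbol loses the square of a
  sign.\<close>

lemma gsum_odd:
  assumes "c > 0" "odd c" "coprime a c" "coprime (det G) c" and G: "even_sym n G"
  shows "gsum n G c a = of_int (kronecker (det G) c) * gauss_sum (2 * a) c ^ n"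
  using assms(1-4)
proof (induction c arbitrary: a rule: pos_int_prime_induct)
  case one
  then show ?case
    by (simp only: gsum_def sum_box_vecs_modulus_1) (simp add: gauss_sum_def ec_dvd)
next
  case (times p d)
  have p0: "p > 0" using times.hyps(1) by (rule prime_gt_0_int)
  have odd: "odd p" "odd d" using times.prems(1) by auto
  have p2: "p \<noteq> 2" using odd by auto
  have cop: "coprime a p" "coprime (det G) p" "coprime a d" "coprime (det G) d"
    using times.prems by auto
  have nd: "\<not> p dvd a" "\<not> p dvd det G"
    using cop times.hyps(1) not_coprimeI[of p _ p] not_prime_unit by auto
  show ?case
  proof (cases "p dvd d")
    case False
    then have pd: "coprime p d" using times.hyps(1) by (simp add: prime_imp_coprime)
    have apd: "\<not> p dvd a * d" "coprime (a * p) d"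
      using nd(1) False times.hyps(1) cop(3) pd by (auto simp: prime_dvd_mult_iff)
    have "gsum n G (p * d) a = gsum n G p (a * d) * gsum n G d (a * p)"
      by (rule gsum_mult[OF p0 times.hyps(2) pd G])
    also have "gsum n G p (a * d) = of_int (kronecker_prime (det G) p) * gauss_sum (2 * (a * d)) p ^ n"
      using gsum_odd_prime[OF times.hyps(1) odd(1) apd(1) G nd(2)] p2 by (simp add: kronecker_prime_def)
    also have "gsum n G d (a * p) = of_int (kronecker (det G) d) * gauss_sum (2 * (a * p)) d ^ n"
      using times.IH[OF times.hyps(2) less_prime_mult[OF times.hyps] odd(2) apd(2) cop(4)] .
    finally show ?thesis
      unfolding kronecker_prime_times[OF times.hyps] gauss_sum_times[OF p0 times.hyps(2) pd]
      by (simp add: power_mult_distrib mult_ac)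
  next
    case True
    then obtain e where d: "d = p * e" by (elim dvdE)
    have e: "e > 0" using times.hyps(2) p0 d by (simp add: zero_less_mult_iff)
    have lt: "e < p * d"
      using less_prime_mult[OF times.hyps] less_prime_mult[OF times.hyps(1) e] d by simp
    have "gsum n G (p * d) a = of_int p ^ n * gsum n G e a"
      using gsum_square_factor[OF p0 e G cop(1,2)] by (simp add: d mult.assoc)
    also have "gsum n G e a = of_int (kronecker (det G) e) * gauss_sum (2 * a) e ^ n"
      using times.IH[OF e lt] odd cop d by simp
    also have "kronecker (det G) e = kronecker (det G) (p * d)"
      using kronecker_prime_unit[OF times.hyps(1) nd(2)]
      unfolding kronecker_prime_times[OF times.hyps] unfolding d kronecker_prime_times[OF times.hyps(1) e]
      by (simp flip: mult.assoc)
    also have "of_int p ^ n * (of_int (kronecker (det G) (p * d)) * gauss_sum (2 * a) e ^ n) =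
        of_int (kronecker (det G) (p * d)) * (of_int p * gauss_sum (2 * a) e) ^ n"
      by (simp add: power_mult_distrib)
    also have "of_int p * gauss_sum (2 * a) e = gauss_sum (2 * a) (p * d)"
      using gauss_sum_square_factor[OF p0 e odd(1), of "2 * a"] odd(1) cop(1) by (simp add: d mult.assoc)
    finally show ?thesis .
  qed
qed

text \<open>The left side is \<open>gsum\<close> for the matrix \<open>(4 |a|)\<close> with
  multiplier \<open>sgn a\<close>, so the odd case extracts \<open>(4 |a| / c) = (|a| / c)\<close>
  and leaves \<open>g(2 sgn a, c)\<close>. A negative sign is complex conjugation, which is why the
  symbol is that of \<open>|a|\<close> and the sign of \<open>a\<close> sits in the phase.\<close>

lemma gauss_sum_eval:
  assumes c: "c > 0" "odd c" and a: "a \<noteq> 0" "coprime a c"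
  shows "gauss_sum (2 * a) c =
    of_int (kronecker \<bar>a\<bar> c) * of_real (sqrt (of_int c)) * e_fun (of_int (sgn a * (1 - c)) / 8)"
proof -
  have "coprime 2 c" using c(2) by simp
  then have k4: "kronecker (4 * \<bar>a\<bar>) c = kronecker \<bar>a\<bar> c"
    using kronecker_mult_left[OF c(1), of 2 "2 * \<bar>a\<bar>"] kronecker_mult_left[OF c(1), of 2 "\<bar>a\<bar>"]
      kronecker_square[OF c(1), of 2] a(2)
    by (simp flip: mult.assoc)
  have sgn: "coprime (sgn a) c"
    using a(1) by (cases "a > 0") auto
  have "2 * a = sgn a * (2 * \<bar>a\<bar>)"
    by (simp add: sgn_if)
  then have "gauss_sum (2 * a) c = gsum 1 (mat 1 1 (\<lambda>_. 2 * (2 * \<bar>a\<bar>))) c (sgn a)"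
    unfolding gsum_single by (simp only:)
  also have "\<dots> = of_int (kronecker (4 * \<bar>a\<bar>) c) * gauss_sum (2 * sgn a) c"
    using gsum_odd[OF c sgn _ even_sym_single, of "2 * \<bar>a\<bar>"] a c(2)
      coprime_power_left_iff[of 2 2 c]
    unfolding det_single_mat by simp
  also have "gauss_sum (2 * sgn a) c = of_real (sqrt (of_int c)) * e_fun (of_int (sgn a * (1 - c)) / 8)"
  proof (cases "a > 0")
    case True
    then show ?thesis using gauss_sum_two[OF c] by simp
  next
    case False
    have "gauss_sum (- 2) c = cnj (gauss_sum 2 c)"
      by (simp add: gauss_sum_def flip: ec_uminus)
    also have "\<dots> = of_real (sqrt (of_int c)) * e_fun (- (of_int (1 - c) / 8))"
      using cnj_e_fun_of_real[of "of_int (1 - c) / 8"] by (simp add: gauss_sum_two[OF c])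
    finally show ?thesis using False a(1) by (simp add: sgn_if diff_divide_distrib)
  qed
  finally show ?thesis by (simp add: k4)
qed

text \<open>Removing the factor 4 lowers \<open>k\<close> by 2, with the moduli 1 and 2 as base. As
  \<open>n\<close> is even and the symbol is a sign, the factor \<open>2 ^ n\<close> is the square
  of the value at the modulus 2.\<close>

lemma gsum_two_power:
  assumes G: "even_sym n G" "odd (det G)" and n: "even n" and a: "odd a"
  shows "gsum n G (2 ^ k) a = (2 ^ (n div 2) * of_int (kronecker_prime (det G) 2)) ^ k"
proof (induction k rule: less_induct)
  case (less k)
  consider "k = 0" | "k = 1" | j where "k = Suc (Suc j)"
    by (metis One_nat_def not0_implies_Suc)
  then show ?case
  proof cases
    case 1
    then show ?thesis by (simp only: gsum_def power_0 sum_box_vecs_modulus_1) (simp add: ec_dvd)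
  next
    case 2
    then show ?thesis using gsum_2[OF a G] by simp
  next
    case 3
    have unit: "kronecker_prime (det G) 2 * kronecker_prime (det G) 2 = 1"
      using G(2) by (intro kronecker_prime_unit) auto
    have "gsum n G (2 ^ k) a = 2 ^ n * gsum n G (2 ^ j) a"
      using gsum_square_factor[of 2 "2 ^ j" n G a] G a by (simp add: 3)
    also have "(2 :: complex) ^ n = 2 ^ (n div 2) * 2 ^ (n div 2)"
      using n by (simp flip: power_add mult_2)
    also have "\<dots> = (2 ^ (n div 2) * of_int (kronecker_prime (det G) 2)) ^ 2"
      using arg_cong[OF unit, of complex_of_int] by (simp add: power2_eq_square)
    finally show ?thesis
      using less.IH[of j] by (simp add: 3 power2_eq_square)
  qed
qed

lemma kronecker_two_power_times:
  assumes "d > 0"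
  shows "kronecker m (2 ^ k * d) = kronecker_prime m 2 ^ k * kronecker m d"
proof (induction k)
  case (Suc k)
  then show ?case
    using kronecker_prime_times[of 2 "2 ^ k * d" m] assms by (simp add: mult.assoc)
qed simp

lemma gsum_eval:
  assumes c: "c > 0" "c = 2 ^ k * c0" "odd c0" and G: "even_sym n G" "coprime (det G) c"
    and a: "a \<noteq> 0" "coprime a c"
  shows "gsum n G c a = of_real (sqrt (of_int c)) ^ n * of_int (kronecker \<bar>a\<bar> c ^ n) *
    of_int (kronecker (det G) c) * e_fun (of_int (int n * sgn a * (1 - c0)) / 8)"
proof -
  have c0: "c0 > 0" using c by (simp add: zero_less_mult_iff)
  have root: "e_fun (of_int (sgn a * (1 - c0)) / 8) ^ n = e_fun (of_int (int n * sgn a * (1 - c0)) / 8)"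
    by (simp add: e_fun_power mult.assoc)
  show ?thesis
  proof (cases "k = 0")
    case True
    then have "c0 = c" "odd c" using c by simp_all
    then show ?thesis
      using gsum_odd[OF c(1) \<open>odd c\<close> a(2) G(2,1)] gauss_sum_eval[OF c(1) \<open>odd c\<close> a] root
      by (simp add: power_mult_distrib mult_ac)
  next
    case False
    then have "even c" using c(2) by simp
    then have odd: "odd a" "odd (det G)"
      using a(2) G(2) coprime_common_divisor[of _ c 2] by (auto simp: coprime_commute)
    have n: "even n" using gsum_2[OF odd(1) G(1) odd(2)] by simp
    have cop: "coprime (2 ^ k) c0" using c(3) by simp
    have cop0: "coprime a c0" "coprime (det G) c0" "coprime (a * 2 ^ k) c0"
      using a(2) G(2) c by auto
    have "gsum n G c a = gsum n G (2 ^ k) (a * c0) * gsum n G c0 (a * 2 ^ k)"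
      unfolding c(2) by (rule gsum_mult[OF _ c0 cop G(1)]) simp
    also have "gsum n G (2 ^ k) (a * c0) = (2 ^ (n div 2) * of_int (kronecker_prime (det G) 2)) ^ k"
      using odd c(3) by (intro gsum_two_power G(1) n) auto
    also have "gsum n G c0 (a * 2 ^ k) = of_int (kronecker (det G) c0) * gauss_sum (2 * (a * 2 ^ k)) c0 ^ n"
      by (rule gsum_odd[OF c0 c(3) cop0(3,2) G(1)])
    also have "gauss_sum (2 * (a * 2 ^ k)) c0 ^ n =
        of_int (kronecker \<bar>a * 2 ^ k\<bar> c0 ^ n) * of_real (sqrt (of_int c0)) ^ n *
        e_fun (of_int (sgn (a * 2 ^ k) * (1 - c0)) / 8) ^ n"
      using a(1) cop0(3) by (subst gauss_sum_eval[OF c0 c(3)]) (auto simp: power_mult_distrib)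
    \<comment> \<open>An even power of a sign. The factor \<open>kronecker |a| c ^ n\<close> of the
      claim is 1 for the same reason and is put back at the end.\<close>
    also have "kronecker \<bar>a * 2 ^ k\<bar> c0 ^ n = 1"
      using kronecker_even_power[OF c0 _ n] cop0(3) by simp
    also have "sgn (a * 2 ^ k) = sgn a" by (simp add: sgn_mult)
    finally have "gsum n G c a = (2 ^ (n div 2)) ^ k * of_real (sqrt (of_int c0)) ^ n *
        of_int (kronecker_prime (det G) 2 ^ k * kronecker (det G) c0) *
        e_fun (of_int (int n * sgn a * (1 - c0)) / 8)"
      unfolding root by (simp add: power_mult_distrib mult_ac)
    also have "kronecker_prime (det G) 2 ^ k * kronecker (det G) c0 = kronecker (det G) c"
      unfolding c(2) by (rule kronecker_two_power_times[OF c0, symmetric])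
    also have "(2 ^ (n div 2)) ^ k * complex_of_real (sqrt (of_int c0)) ^ n = of_real (sqrt (of_int c)) ^ n"
    proof -
      obtain m where m: "n = 2 * m" using n by (elim evenE)
      have "complex_of_real (sqrt (of_int d)) ^ n = of_int d ^ m" if "d > 0" for d
        unfolding m power_mult using that by (simp flip: of_real_power)
      from this[OF c0] this[OF c(1)] show ?thesis
        by (simp add: m c(2) power_mult_distrib mult.commute flip: power_mult)
    qed
    finally show ?thesis
      using kronecker_even_power[OF c(1) _ n, of "\<bar>a\<bar>"] a(2) by simp
  qed
qed

section \<open>Reduction to the homogeneous sum\<close>

lemma integral_vecE:
  assumes "integral_vec v" "v \<in> carrier_vec n"
  obtains u where "u \<in> carrier_vec n" "rat_vec u = v"
proof
  show "map_vec floor v \<in> carrier_vec n" using assms by simp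
  show "rat_vec (map_vec floor v) = v"
    using assms by (intro eq_vecI) (auto simp: integral_vec_def)
qed

lemma even_sym_of_even_integral:
  assumes G: "G \<in> carrier_mat n n" "transpose_mat G = G" "even_integral (rat_mat G)"
  shows "even_sym n G"
  unfolding even_sym_def
proof (intro conjI allI impI G(1,2))
  fix i assume "i < n"
  then obtain m where "rat_of_int (G $$ (i, i)) = of_int (2 * m)"
    using G(1,3) by (auto simp: even_integral_def)
  then show "even (G $$ (i, i))" by (simp only: of_int_eq_iff) simp
qed

lemma rat_mat_inj: "rat_mat A = rat_mat B \<Longrightarrow> A = B"
  by (rule of_int_hom.mat_hom_inj)

text \<open>Symmetry of \<open>H\<close> follows by evaluating \<open>H^T G H\<close> in two ways,
  as \<open>N H^T\<close> and as \<open>N H\<close>. That \<open>H\<close> is even, the defining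
  property of the level, makes its half form integral on integer vectors.\<close>

lemma level_matrix:
  assumes G: "G \<in> carrier_mat n n" "transpose_mat G = G" and d: "det G \<noteq> 0"
  obtains H where "even_sym n H" "rat_mat H = rat_of_nat (level G) \<cdot>\<^sub>m inv_mat (rat_mat G)"
    "G * H = int (level G) \<cdot>\<^sub>m 1\<^sub>m n"
proof -
  let ?A = "rat_mat G" and ?N = "level G"
  have A: "?A \<in> carrier_mat n n" "det ?A \<noteq> 0" using G d by auto
  note I = inv_mat[OF A]
  note lev = level[OF G(1) d]
  let ?M = "rat_of_nat ?N \<cdot>\<^sub>m inv_mat ?A"
  define H where "H = map_mat floor ?M"
  have H: "H \<in> carrier_mat n n" using I(1) by (simp add: H_def)
  have M: "?M \<in> carrier_mat n n" using I(1) by simp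
  have ratH: "rat_mat H = ?M"
    using lev(2) M by (intro eq_matI) (auto simp: H_def even_integral_def)
  have "rat_mat (G * H) = ?A * ?M"
    unfolding ratH[symmetric] by (rule of_int_hom.mat_hom_mult[OF G(1) H])
  also have "\<dots> = rat_mat (int ?N \<cdot>\<^sub>m 1\<^sub>m n)"
    using mult_smult_distrib[OF A(1) I(1)] I(2) by (auto intro!: eq_matI)
  finally have GH: "G * H = int ?N \<cdot>\<^sub>m 1\<^sub>m n" by (rule rat_mat_inj)
  have HT: "transpose_mat H \<in> carrier_mat n n" using H by simp
  have HTG: "transpose_mat H * G = int ?N \<cdot>\<^sub>m 1\<^sub>m n"
    using transpose_mult[OF G(1) H] unfolding GH G(2) by (simp add: transpose_smult_mat)
  have "int ?N \<cdot>\<^sub>m transpose_mat H = transpose_mat H * (G * H)"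
    unfolding GH using mult_smult_distrib[OF HT one_carrier_mat[of n]] HT by simp
  also have "\<dots> = (transpose_mat H * G) * H"
    by (rule assoc_mult_mat[OF HT G(1) H, symmetric])
  also have "\<dots> = int ?N \<cdot>\<^sub>m H"
    unfolding HTG using mult_smult_assoc_mat[OF one_carrier_mat[of n] H] H by simp
  finally have eq: "int ?N \<cdot>\<^sub>m transpose_mat H = int ?N \<cdot>\<^sub>m H" .
  have sym: "transpose_mat H = H"
  proof (rule eq_matI)
    fix i j assume ij: "i < dim_row H" "j < dim_col H"
    then have "int ?N * transpose_mat H $$ (i, j) = int ?N * H $$ (i, j)"
      using arg_cong[OF eq, of "\<lambda>M. M $$ (i, j)"] H by simp
    then show "transpose_mat H $$ (i, j) = H $$ (i, j)" using lev(1) by simp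
  qed (use H in auto)
  have "even_integral (rat_mat H)" using lev(2) unfolding ratH .
  then have "even_sym n H"
    by (rule even_sym_of_even_integral[OF H sym])
  then show ?thesis using that ratH GH by blast
qed

text \<open>The linear term is removed by the shift \<open>s\<close> with \<open>a G s \<equiv> z (mod c)\<close>.\<close>

lemma sum_linear_term:
  assumes c: "c > 0" and G: "even_sym n G" and z: "z \<in> carrier_vec n"
    and s: "s \<in> carrier_vec n" "G *\<^sub>v s = k \<cdot>\<^sub>v z" "[a * k = 1] (mod c)"
  shows "(\<Sum>v\<in>box_vecs n c. ec c (a * half_form G v + v \<bullet> z)) = ec c (- (a * half_form G s)) * gsum n G c a"
proof -
  have "gsum n G c a = (\<Sum>v\<in>box_vecs n c. ec c (a * half_form G (1\<^sub>m n *\<^sub>v v + s)))"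
    unfolding gsum_def
    by (intro sum_box_vecs_affine[symmetric] c s ec_cong cong_mult half_form_cong[OF G]) auto
  also have "\<dots> = (\<Sum>v\<in>box_vecs n c. ec c (a * half_form G s) * ec c (a * half_form G v + v \<bullet> z))"
  proof (intro sum.cong refl)
    fix v assume "v \<in> box_vecs n c"
    then have v: "v \<in> carrier_vec n" by (rule box_vecs_carrier)
    have "a * half_form G (1\<^sub>m n *\<^sub>v v + s) = a * half_form G v + (a * k) * (v \<bullet> z) + a * half_form G s"
      using v s(1) z by (simp add: half_form_add[OF G] s(2) algebra_simps)
    also have "[\<dots> = a * half_form G v + 1 * (v \<bullet> z) + a * half_form G s] (mod c)"
      by (intro cong_add cong_mult cong_refl s(3))
    finally have "ec c (a * half_form G (1\<^sub>m n *\<^sub>v v + s)) =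
        ec c (a * half_form G v + 1 * (v \<bullet> z) + a * half_form G s)"
      by (rule ec_cong)
    then show "ec c (a * half_form G (1\<^sub>m n *\<^sub>v v + s)) =
        ec c (a * half_form G s) * ec c (a * half_form G v + v \<bullet> z)"
      by (simp add: ec_add mult_ac)
  qed
  finally have "gsum n G c a = ec c (a * half_form G s) *
      (\<Sum>v\<in>box_vecs n c. ec c (a * half_form G v + v \<bullet> z))"
    by (simp add: sum_distrib_left)
  moreover have "ec c (- (a * half_form G s)) * ec c (a * half_form G s) = 1"
    by (simp flip: ec_add)
  ultimately show ?thesis
    by (simp flip: mult.assoc)
qed

text \<open>The left side is half the form at \<open>v + t\<close> minus half of
  \<open>qform B x\<close>. It is stated in expanded form because \<open>v\<close> is integral but
  \<open>t\<close> is not; the mixed term becomes the linear term of an integral sum.\<close>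

lemma complete_square:
  fixes A B :: "rat mat"
  assumes A: "A \<in> carrier_mat n n" "transpose_mat A = A"
    and B: "B \<in> carrier_mat n n" "A * B = 1\<^sub>m n"
    and v: "v \<in> carrier_vec n" "w \<in> carrier_vec n" "x \<in> carrier_vec n"
  defines "t \<equiv> w + B *\<^sub>v x"
  shows "1 / 2 * qform A (v + w) + (v + w) \<bullet> x =
    1 / 2 * qform A v + v \<bullet> (A *\<^sub>v t) + 1 / 2 * qform A t - 1 / 2 * qform B x"
proof -
  let ?g = "B *\<^sub>v x"
  have g: "?g \<in> carrier_vec n" using B v by simp
  have Ag: "A *\<^sub>v ?g = x"
    using v B A by (simp flip: assoc_mult_mat_vec)
  have sym: "p \<bullet> (A *\<^sub>v q) = q \<bullet> (A *\<^sub>v p)" if "p \<in> carrier_vec n" "q \<in> carrier_vec n" for p q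
    using transpose_vec_mult_scalar[OF A(1) that(2,1)] that A
    by (metis comm_scalar_prod mult_mat_vec_carrier)
  have Av: "A *\<^sub>v v \<in> carrier_vec n" "A *\<^sub>v w \<in> carrier_vec n" using A v by auto
  have "?g \<bullet> (A *\<^sub>v w) = w \<bullet> x" using sym[OF g v(2)] by (simp add: Ag)
  moreover have "w \<bullet> (A *\<^sub>v v) = v \<bullet> (A *\<^sub>v w)" by (rule sym[OF v(2,1)])
  moreover have "?g \<bullet> x = x \<bullet> ?g" by (rule comm_scalar_prod[OF g v(3)])
  ultimately show ?thesis
    using v g Av
    by (simp add: qform_def t_def mult_add_distrib_mat_vec[OF A(1)] Ag scalar_prod_add_distrib[of _ n]
        add_scalar_prod_distrib[of _ n] field_simps)
qed

lemma rat_vec_scalar_prod: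
  "v \<in> carrier_vec n \<Longrightarrow> w \<in> carrier_vec n \<Longrightarrow> rat_vec v \<bullet> rat_vec w = of_int (v \<bullet> w)"
  by (simp add: scalar_prod_def)

lemma rat_mat_mult_vec:
  "A \<in> carrier_mat m n \<Longrightarrow> v \<in> carrier_vec n \<Longrightarrow> rat_mat A *\<^sub>v rat_vec v = rat_vec (A *\<^sub>v v)"
  by (intro eq_vecI) (simp_all add: scalar_prod_def)

lemma ec_of_rat: "ec c m = e_fun (of_rat (of_int m / of_int c))"
  by (simp add: ec_def of_rat_divide)

lemma e_fun_of_rat_add: "e_fun (of_rat (x + y)) = e_fun (of_rat x) * e_fun (of_rat y)"
  by (simp add: of_rat_add e_fun_add)

lemma powr_half_of_nat: "x > 0 \<Longrightarrow> x powr (of_nat n / 2) = sqrt x ^ n"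
  using powr_power[of x "1 / 2" n] by (simp add: powr_half_sqrt)

theorem theorem4p6:
  fixes n N k :: nat
    and G :: "int mat"
    and D a c c0 c' :: int
    and w x :: "rat vec"
  assumes n: "n \<ge> 1"
    and G: "G \<in> carrier_mat n n"
    and symmetric: "transpose_mat G = G"
    and even_integral: "even_integral (rat_mat G)"
    and nonsingular: "det G \<noteq> 0"
    and D: "D = det G"
    and N: "N = level G"
    and c_pos: "c > 0"
    and N_c: "gcd (int N) c = 1"
    and odd_part: "c = 2 ^ k * c0" "odd c0"
    and a_nonzero: "a \<noteq> 0"
    and a_c: "gcd a c = 1"
    and w: "w \<in> carrier_vec n" "integral_vec (rat_mat G *\<^sub>v w)"
    and x: "x \<in> carrier_vec n" "integral_vec (rat_of_int a \<cdot>\<^sub>v x)"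
    and c': "[c * c' = 1] (mod (a * int N))"
  shows "(\<Sum>v\<in>box_vecs n c.
            e_fun (of_rat (of_int a / of_int c *
              (1 / 2 * qform (rat_mat G) (rat_vec v + w) + (rat_vec v + w) \<bullet> x))))
       = of_real (of_int c powr (of_nat n / 2))
         * of_int (kronecker \<bar>a\<bar> c ^ n) * of_int (kronecker D c)
         * e_fun (of_int (int n * sgn a * (1 - c0)) / 8)
         * e_fun (of_rat (- (of_int a / (2 * of_int c)) * qform (inv_mat (rat_mat G)) x
             + of_int (a * c') / 2
               * qform (rat_mat G) (w + inv_mat (rat_mat G) *\<^sub>v x)))"
proof -
  let ?A = "rat_mat G" and ?B = "inv_mat (rat_mat G)"
  have even_G: "even_sym n G" by (rule even_sym_of_even_integral[OF G symmetric even_integral])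
  have A: "?A \<in> carrier_mat n n" "det ?A \<noteq> 0" "transpose_mat ?A = ?A"
    using G nonsingular even_sym_index[OF even_G] by (auto intro!: eq_matI)
  note B = inv_mat[OF A(1,2)]
  obtain H where H: "even_sym n H" "rat_mat H = rat_of_nat N \<cdot>\<^sub>m ?B" "G * H = int N \<cdot>\<^sub>m 1\<^sub>m n"
    using level_matrix[OF G symmetric nonsingular] unfolding N by blast
  note Hc = even_symD(1)[OF H(1)]
  have N0: "N > 0" using level(1)[OF G nonsingular] by (simp add: N)
  \<comment> \<open>Hence \<open>det G\<close> divides a power of the level and is prime to
    \<open>c\<close>.\<close>
  have "det G * det H = int N ^ n"
    using det_mult[OF G Hc] by (simp add: H(3) det_smult)
  moreover have "coprime (int N) c"
    using N_c by (simp add: coprime_iff_gcd_eq_1)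
  then have "coprime (int N ^ n) c" by simp
  ultimately have det_c: "coprime (det G) c"
    by (metis coprime_mult_left_iff)
  have cop_a: "coprime a c" using a_c by (simp add: coprime_iff_gcd_eq_1)

  obtain u where u: "u \<in> carrier_vec n" "rat_vec u = ?A *\<^sub>v w"
    using integral_vecE[OF w(2)] A(1) w(1) by (metis mult_mat_vec_carrier)
  obtain y where y: "y \<in> carrier_vec n" "rat_vec y = rat_of_int a \<cdot>\<^sub>v x"
    using integral_vecE[OF x(2)] x(1) by (metis smult_carrier_vec)
  \<comment> \<open>\<open>z\<close> is the integer vector \<open>a G t\<close>: the hypotheses make
    \<open>G w\<close> and \<open>a x\<close> integral, although \<open>t\<close> need not
    be.\<close>
  define z where "z = a \<cdot>\<^sub>v u + y"
  define t where "t = w + ?B *\<^sub>v x"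
  have z: "z \<in> carrier_vec n" using u y by (simp add: z_def)
  have Bx: "?B *\<^sub>v x \<in> carrier_vec n" using B(1) x(1) by simp
  have t: "t \<in> carrier_vec n" using w(1) Bx by (simp add: t_def)
  have "?A *\<^sub>v (?B *\<^sub>v x) = x"
    using assoc_mult_mat_vec[OF A(1) B(1) x(1)] B(2) x(1) by simp
  then have At: "?A *\<^sub>v t = rat_vec u + x"
    unfolding t_def u(2) using mult_add_distrib_mat_vec[OF A(1) w(1) Bx] by simp
  have rat_z: "rat_vec z = rat_of_int a \<cdot>\<^sub>v (?A *\<^sub>v t)"
  proof (rule eq_vecI)
    fix i assume "i < dim_vec (rat_of_int a \<cdot>\<^sub>v (?A *\<^sub>v t))"
    then have i: "i < n" using A(1) by simp
    have "rat_of_int (y $ i) = rat_of_int a * x $ i"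
      using arg_cong[OF y(2), of "\<lambda>v. v $ i"] i y(1) x(1) by simp
    then show "rat_vec z $ i = (rat_of_int a \<cdot>\<^sub>v (?A *\<^sub>v t)) $ i"
      unfolding At using i u(1) y(1) x(1) by (simp add: z_def distrib_left)
  qed (use z A(1) in simp)
  \<comment> \<open>From \<open>H z = a N t\<close> the value of the form at \<open>t\<close> is
    \<open>2 m / (a^2 N)\<close>, with \<open>m\<close> an integer because \<open>H\<close> is
    even.\<close>
  define m where "m = half_form H z"
  have a0: "rat_of_int a \<noteq> 0" "rat_of_int c \<noteq> 0" "rat_of_nat N \<noteq> 0"
    using a_nonzero c_pos N0 by simp_all
  have At_c: "?A *\<^sub>v t \<in> carrier_vec n" using A(1) t by simp
  have "?B *\<^sub>v (?A *\<^sub>v t) = t"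
    using assoc_mult_mat_vec[OF B(1) A(1) t] B(3) t by simp
  then have "rat_mat H *\<^sub>v rat_vec z = (rat_of_nat N * rat_of_int a) \<cdot>\<^sub>v t"
    unfolding H(2) rat_z using B(1) At_c
    by (simp add: mult_mat_vec_smult[of _ n n] smult_mat_mult_vec[of _ n n] smult_smult_assoc
        mult.commute)
  then have "rat_of_int (z \<bullet> (H *\<^sub>v z)) = (rat_of_int a \<cdot>\<^sub>v (?A *\<^sub>v t)) \<bullet> ((rat_of_nat N * rat_of_int a) \<cdot>\<^sub>v t)"
    using z Hc by (simp add: rat_mat_mult_vec[OF Hc z] flip: rat_vec_scalar_prod[of _ n] rat_z)
  then have qt: "qform ?A t = 2 * rat_of_int m / (rat_of_int a ^ 2 * rat_of_nat N)"
    using two_half_form[OF H(1) z, folded m_def] t At_c a0 comm_scalar_prod[OF At_c t]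
    by (simp add: qform_def field_simps power2_eq_square)

  obtain M where M: "c * c' - 1 = a * int N * M"
    using c' by (auto simp: cong_iff_dvd_diff)
  \<comment> \<open>Chosen so that \<open>G s = - M N z\<close>, where
    \<open>- a M N = 1 - c c'\<close> is 1 modulo \<open>c\<close>.\<close>
  define s where "s = (- M) \<cdot>\<^sub>v (H *\<^sub>v z)"
  have Hz: "H *\<^sub>v z \<in> carrier_vec n" using Hc z by simp
  have GHz: "G *\<^sub>v (H *\<^sub>v z) = int N \<cdot>\<^sub>v z"
    using assoc_mult_mat_vec[OF G Hc z] z by (simp add: H(3) smult_mat_mult_vec[of _ n n])
  have s: "s \<in> carrier_vec n" using Hz by (simp add: s_def)
  have Gs: "G *\<^sub>v s = (- M * int N) \<cdot>\<^sub>v z"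
    unfolding s_def mult_mat_vec_smult[OF G Hz] GHz by (simp add: smult_smult_assoc)
  have "a * (- M * int N) = 1 - c * c'" using M by (simp add: mult_ac)
  then have unit: "[a * (- M * int N) = 1] (mod c)" by (simp add: cong_iff_dvd_diff)
  have "2 * half_form G (H *\<^sub>v z) = 2 * (int N * m)"
    using two_half_form[OF even_G Hz] two_half_form[OF H(1) z] comm_scalar_prod[OF Hz z] z Hz
    by (simp add: GHz m_def)
  then have hs: "half_form G s = M\<^sup>2 * int N * m"
    using half_form_smult[OF even_G Hz, of "- M"] by (simp add: s_def)

  define r where "r = rat_of_int a / (2 * rat_of_int c)"
  have term_eq: "e_fun (of_rat (of_int a / of_int c *
        (1 / 2 * qform ?A (rat_vec v + w) + (rat_vec v + w) \<bullet> x)))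
      = ec c (a * half_form G v + v \<bullet> z) * e_fun (of_rat (r * qform ?A t - r * qform ?B x))"
    if "v \<in> box_vecs n c" for v
  proof -
    have v: "v \<in> carrier_vec n" "rat_vec v \<in> carrier_vec n"
      using box_vecs_carrier[OF that] by auto
    have "qform ?A (rat_vec v) = 2 * rat_of_int (half_form G v)"
      using two_half_form[OF even_G v(1)] rat_vec_scalar_prod[OF v(1) mult_mat_vec_carrier[OF G v(1)]]
      by (simp add: qform_def rat_mat_mult_vec[OF G v(1)])
    moreover have "rat_of_int a * (rat_vec v \<bullet> (?A *\<^sub>v t)) = rat_of_int (v \<bullet> z)"
      using rat_vec_scalar_prod[OF v(1) z] v(2) At_c by (simp add: rat_z)
    ultimately have "of_int a / of_int c * (1 / 2 * qform ?A (rat_vec v + w) + (rat_vec v + w) \<bullet> x)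
      = of_int (a * half_form G v + v \<bullet> z) / of_int c + (r * qform ?A t - r * qform ?B x)"
      unfolding complete_square[OF A(1,3) B(1,2) v(2) w(1) x(1), folded t_def] r_def
      using a0 by (simp add: field_simps)
    then show ?thesis by (simp only: e_fun_of_rat_add ec_of_rat)
  qed
  \<comment> \<open>Apart from the common term in \<open>qform ?B x\<close>, both exponents are
    rational multiples of \<open>m\<close>. With \<open>T = a N M = c c' - 1\<close> they differ by
    \<open>m (1 - T^2 - c c') / (a N c)\<close>. Since \<open>1 - T^2 - c c' = - T c c'\<close>, the
    denominator cancels and the difference is the integer \<open>- m M c'\<close>.\<close>
  have phase: "ec c (- (a * half_form G s)) * e_fun (of_rat (r * qform ?A t - r * qform ?B x))
      = e_fun (of_rat (- r * qform ?B x + of_int (a * c') / 2 * qform ?A t))"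
  proof -
    let ?N = "rat_of_nat N" and ?a = "rat_of_int a" and ?c = "rat_of_int c"
    have M': "?a * ?N * rat_of_int M = ?c * rat_of_int c' - 1"
      using arg_cong[OF M, of rat_of_int] by simp
    have "rat_of_int (- (a * half_form G s)) / ?c + r * qform ?A t - of_int (a * c') / 2 * qform ?A t =
        rat_of_int m * (1 - (?a * ?N * rat_of_int M)\<^sup>2 - ?c * rat_of_int c') / (?a * ?N * ?c)"
      using a0 by (simp add: hs qt r_def field_simps power2_eq_square)
    also have "1 - (?a * ?N * rat_of_int M)\<^sup>2 - ?c * rat_of_int c' =
        - (?a * ?N * rat_of_int M * (?c * rat_of_int c'))"
      unfolding M' by (simp add: power2_eq_square algebra_simps)
    also have "rat_of_int m * - (?a * ?N * rat_of_int M * (?c * rat_of_int c')) / (?a * ?N * ?c) =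
        rat_of_int (- m * M * c')"
      using a0 by (simp add: field_simps)
    finally have "rat_of_int (- (a * half_form G s)) / ?c + (r * qform ?A t - r * qform ?B x) =
        rat_of_int (- m * M * c') + (- r * qform ?B x + of_int (a * c') / 2 * qform ?A t)"
      by (simp add: algebra_simps)
    then show ?thesis
      unfolding ec_of_rat e_fun_of_rat_add[symmetric] by (simp only: e_fun_of_rat_add of_rat_of_int_eq e_fun_of_int mult_1)
  qed
  have "(\<Sum>v\<in>box_vecs n c.
      e_fun (of_rat (of_int a / of_int c *
        (1 / 2 * qform ?A (rat_vec v + w) + (rat_vec v + w) \<bullet> x)))) =
      (\<Sum>v\<in>box_vecs n c. ec c (a * half_form G v + v \<bullet> z)) *
      e_fun (of_rat (r * qform ?A t - r * qform ?B x))"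
    by (simp only: sum_distrib_right term_eq cong: sum.cong)
  also have "\<dots> = gsum n G c a * e_fun (of_rat (- r * qform ?B x + of_int (a * c') / 2 * qform ?A t))"
    unfolding phase[symmetric] sum_linear_term[OF c_pos even_G z s Gs unit] by (simp only: mult_ac)
  also have "gsum n G c a = of_real (of_int c powr (of_nat n / 2)) * of_int (kronecker \<bar>a\<bar> c ^ n) *
      of_int (kronecker D c) * e_fun (of_int (int n * sgn a * (1 - c0)) / 8)"
    using gsum_eval[OF c_pos odd_part even_G det_c a_nonzero cop_a] c_pos
    by (simp add: D powr_half_of_nat)
  finally show ?thesis
    unfolding r_def t_def .
qed

end
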